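(* Let $m,n\ge 2$ be integers, $\mathbb{K}$ a field, $S=\mathbb{K}[x_{i,j}: i\in[m], j\in[n]]$, and $\mathcal{J}_{K_m,P_n}\subseteq S$ the ideal generated by $x_{i,k}x_{j,k+1}-x_{i,k+1}x_{j,k}$ for $1\le i<j\le m$, $k\in[n-1]$. Then for every positive integer $t$, $\mathcal{J}_{K_m,P_n}^{(t)}=\mathcal{J}_{K_m,P_n}^t$.
   Context: For an ideal $I$ of $S$, the $t$-th symbolic power is $I^{(t)}=\bigcap_{\mathfrak p\in\operatorname{Ass}(I)}(I^tS_{\mathfrak p}\cap S)$. *)

theory Defs
  imports "HOL-Library.Poly_Mapping"
begin

text \<open>Multivariate polynomials over a coefficient ring 'a in variables indexed by 'v:
  finitely supported maps from monomials (exponent vectors 'v =>0 nat) to coefficients.\<close>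
type_synonym ('v, 'a) mpoly = "('v \<Rightarrow>\<^sub>0 nat) \<Rightarrow>\<^sub>0 'a"

definition Var :: "'v \<Rightarrow> ('v, 'a::comm_ring_1) mpoly" where
  "Var v = Poly_Mapping.single (Poly_Mapping.single v 1) 1"

text \<open>The polynomial ring S = K[x_{i,j} : i in [m], j in [n]], as the subring of polynomials
  only involving the variables (i,j) with 1 <= i <= m, 1 <= j <= n.\<close>
definition polyS :: "nat \<Rightarrow> nat \<Rightarrow> (nat \<times> nat, 'a::comm_ring_1) mpoly set" where
  "polyS m n = {f. \<forall>\<mu>\<in>Poly_Mapping.keys f. Poly_Mapping.keys \<mu> \<subseteq> {1..m} \<times> {1..n}}"

text \<open>Ideals of a subring R (given by its carrier set) of a commutative ring type.\<close>
definition is_ideal :: "'a::comm_ring_1 set \<Rightarrow> 'a set \<Rightarrow> bool" where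
  "is_ideal R I \<longleftrightarrow> I \<subseteq> R \<and> 0 \<in> I \<and> (\<forall>a\<in>I. \<forall>b\<in>I. a + b \<in> I) \<and>
     (\<forall>a\<in>I. - a \<in> I) \<and> (\<forall>r\<in>R. \<forall>a\<in>I. r * a \<in> I)"

definition ideal_gen :: "'a::comm_ring_1 set \<Rightarrow> 'a set \<Rightarrow> 'a set" where
  "ideal_gen R G = \<Inter>{I. is_ideal R I \<and> G \<subseteq> I}"

definition ideal_prod :: "'a::comm_ring_1 set \<Rightarrow> 'a set \<Rightarrow> 'a set \<Rightarrow> 'a set" where
  "ideal_prod R I J = ideal_gen R {a * b | a b. a \<in> I \<and> b \<in> J}"

primrec ideal_pow :: "'a::comm_ring_1 set \<Rightarrow> 'a set \<Rightarrow> nat \<Rightarrow> 'a set" where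
  "ideal_pow R I 0 = R"
| "ideal_pow R I (Suc t) = ideal_prod R (ideal_pow R I t) I"

definition prime_ideal :: "'a::comm_ring_1 set \<Rightarrow> 'a set \<Rightarrow> bool" where
  "prime_ideal R P \<longleftrightarrow> is_ideal R P \<and> P \<noteq> R \<and>
     (\<forall>a\<in>R. \<forall>b\<in>R. a * b \<in> P \<longrightarrow> a \<in> P \<or> b \<in> P)"

definition Ass :: "'a::comm_ring_1 set \<Rightarrow> 'a set \<Rightarrow> 'a set set" where
  "Ass R I = {P. prime_ideal R P \<and> (\<exists>f\<in>R. P = {g\<in>R. g * f \<in> I})}"

text \<open>I^t R_P \<inter> R = {f in R. s f in I^t for some s in R - P}.\<close>
definition loc_contract :: "'a::comm_ring_1 set \<Rightarrow> 'a set \<Rightarrow> 'a set \<Rightarrow> 'a set" where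
  "loc_contract R P J = {f\<in>R. \<exists>s\<in>R - P. s * f \<in> J}"

definition symbolic_power :: "'a::comm_ring_1 set \<Rightarrow> 'a set \<Rightarrow> nat \<Rightarrow> 'a set" where
  "symbolic_power R I t = R \<inter> (\<Inter>P\<in>Ass R I. loc_contract R P (ideal_pow R I t))"

definition J_KmPn :: "nat \<Rightarrow> nat \<Rightarrow> (nat \<times> nat, 'a::field) mpoly set" where
  "J_KmPn m n = ideal_gen (polyS m n)
     {Var (i,k) * Var (j,k+1) - Var (i,k+1) * Var (j,k) | i j k.
        1 \<le> i \<and> i < j \<and> j \<le> m \<and> 1 \<le> k \<and> k \<le> n - 1}"

end

theory Submission
  imports Defs "HOL-Library.Product_Lexorder"
begin

text \<open>
  Give \<open>x\<^sub>i\<^sub>k\<close> the weight \<open>i k\<close>, so that the diagonal term \<open>x\<^sub>i\<^sub>k x\<^sub>j\<^sub>,\<^sub>k\<^sub>+\<^sub>1\<close> of each generator (\<open>i < j\<close>) is its form of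
  highest weight. These diagonals are the edges of a bipartite graph on the variables (split by the parity of the
  column). It suffices that every top-weight monomial \<open>u\<close> of an element \<open>f\<close> of the symbolic power is divisible by \<open>t\<close>
  edges: subtracting multiples of products of \<open>t\<close> minors then lowers the weight of \<open>f\<close>. By the weighted Koenig theorem
  one needs that \<open>u\<close> has degree at least \<open>t\<close> on each vertex cover, and each vertex cover contains the complement of
  some union of lattice paths, one in each block of columns left after deleting a set \<open>T\<close> of pairwise non-adjacent
  inner columns.

  The kernel of the parametrisation with \<open>x\<^sub>r\<^sub>k = \<alpha>\<^sub>r\<^sub>b \<beta>\<^sub>k\<close> in block \<open>b\<close> and \<open>x\<^sub>r\<^sub>k = 0\<close> for \<open>k \<in> T\<close> is an associated
  prime of the ideal. Adding \<open>\<epsilon> y\<^sub>r\<^sub>k\<close> to the image of the variables off the lattice paths sends the ideal into \<open>(\<epsilon>)\<close>, so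
  the image of \<open>f\<close> is divisible by \<open>\<epsilon>\<^sup>t\<close>. The new variables can be weighted such that \<open>\<alpha>\<^sub>r\<^sub>b \<beta>\<^sub>k\<close> is lighter than \<open>y\<^sub>r\<^sub>k\<close> off the
  paths and has weight \<open>r k\<close> on them; the leading monomial of the image of \<open>u\<close> then contains \<open>\<epsilon>\<close> exactly as often as \<open>u\<close>
  contains variables off the paths.
\<close>

section \<open>Ideals of subrings\<close>

definition subring :: "'a::comm_ring_1 set \<Rightarrow> bool" where
  "subring R \<longleftrightarrow> 0 \<in> R \<and> 1 \<in> R \<and> (\<forall>a\<in>R. \<forall>b\<in>R. a + b \<in> R) \<and>
     (\<forall>a\<in>R. - a \<in> R) \<and> (\<forall>a\<in>R. \<forall>b\<in>R. a * b \<in> R)"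

lemma is_ideal_self: "subring R \<Longrightarrow> is_ideal R R"
  by (auto simp: subring_def is_ideal_def)

lemma ideal_zero: "is_ideal R I \<Longrightarrow> 0 \<in> I"
  and ideal_add: "is_ideal R I \<Longrightarrow> a \<in> I \<Longrightarrow> b \<in> I \<Longrightarrow> a + b \<in> I"
  and ideal_uminus: "is_ideal R I \<Longrightarrow> a \<in> I \<Longrightarrow> - a \<in> I"
  and ideal_mult: "is_ideal R I \<Longrightarrow> r \<in> R \<Longrightarrow> a \<in> I \<Longrightarrow> r * a \<in> I"
  and ideal_subset: "is_ideal R I \<Longrightarrow> a \<in> I \<Longrightarrow> a \<in> R"
  by (auto simp: is_ideal_def)

lemma ideal_diff: "is_ideal R I \<Longrightarrow> a \<in> I \<Longrightarrow> b \<in> I \<Longrightarrow> a - b \<in> I"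
  using ideal_add[of R I a "- b"] ideal_uminus[of R I b] by simp

lemma ideal_sum: "is_ideal R I \<Longrightarrow> (\<And>x. x \<in> X \<Longrightarrow> f x \<in> I) \<Longrightarrow> sum f X \<in> I"
  by (induction X rule: infinite_finite_induct) (auto simp: ideal_zero ideal_add)

lemma ideal_gen_least: "is_ideal R I \<Longrightarrow> G \<subseteq> I \<Longrightarrow> ideal_gen R G \<subseteq> I"
  by (auto simp: ideal_gen_def)

lemma ideal_gen_superset: "G \<subseteq> ideal_gen R G"
  by (auto simp: ideal_gen_def)

lemma is_ideal_ideal_gen:
  assumes "subring R" "G \<subseteq> R"
  shows "is_ideal R (ideal_gen R G)"
proof -
  have "ideal_gen R G \<subseteq> R"
    using ideal_gen_least[OF is_ideal_self] assms by blast
  then show ?thesis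
    by (auto simp: ideal_gen_def is_ideal_def)
qed

lemma is_ideal_ideal_pow:
  assumes "subring R" "is_ideal R I"
  shows "is_ideal R (ideal_pow R I t)"
proof (induction t)
  case 0
  then show ?case using assms by (simp add: is_ideal_self)
next
  case (Suc t)
  have "{a * b |a b. a \<in> ideal_pow R I t \<and> b \<in> I} \<subseteq> R"
    using assms ideal_subset[OF Suc] ideal_subset[OF assms(2)] by (auto simp: subring_def)
  then show ?case
    using assms by (simp add: ideal_prod_def is_ideal_ideal_gen)
qed

lemma ideal_pow_SucI: "a \<in> ideal_pow R I t \<Longrightarrow> b \<in> I \<Longrightarrow> a * b \<in> ideal_pow R I (Suc t)"
  unfolding ideal_pow.simps ideal_prod_def
  by (rule subsetD[OF ideal_gen_superset]) blast

text \<open>The colon ideal \<open>I : g\<close>; associated primes are exhibited in this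
  form.\<close>

lemma is_ideal_colon:
  assumes "subring R" "is_ideal R I" "g \<in> R"
  shows "is_ideal R {h \<in> R. h * g \<in> I}"
  using assms unfolding is_ideal_def subring_def
  by (auto simp: distrib_right mult.assoc)

section \<open>Polynomial mappings\<close>

lemma keys_add_nat: "Poly_Mapping.keys (u + v :: 'v \<Rightarrow>\<^sub>0 nat) = Poly_Mapping.keys u \<union> Poly_Mapping.keys v"
  by (auto simp: in_keys_iff lookup_add)

lemma keys_uminus_pm: "Poly_Mapping.keys (- f :: 'b \<Rightarrow>\<^sub>0 'a::ab_group_add) = Poly_Mapping.keys f"
  by (auto simp: in_keys_iff)

lemma keys_diff_pm:
  "Poly_Mapping.keys (f - g :: 'b \<Rightarrow>\<^sub>0 'a::ab_group_add) \<subseteq> Poly_Mapping.keys f \<union> Poly_Mapping.keys g"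
  by (auto simp: in_keys_iff lookup_minus)

lemma poly_mapping_sum_single:
  "(\<Sum>\<mu>\<in>Poly_Mapping.keys f. Poly_Mapping.single \<mu> (Poly_Mapping.lookup f \<mu>)) = f"
proof (rule poly_mapping_eqI)
  fix k
  show "Poly_Mapping.lookup (\<Sum>\<mu>\<in>Poly_Mapping.keys f. Poly_Mapping.single \<mu> (Poly_Mapping.lookup f \<mu>)) k
      = Poly_Mapping.lookup f k"
    by (simp add: lookup_sum lookup_single when_def in_keys_iff)
qed

lemma poly_mapping_induct_single [case_names zero add]:
  assumes "P 0" "\<And>f \<mu> c. P f \<Longrightarrow> P (f + Poly_Mapping.single \<mu> c)"
  shows "P (f :: 'b \<Rightarrow>\<^sub>0 'a::comm_monoid_add)"
proof -
  have "P (\<Sum>\<mu>\<in>X. Poly_Mapping.single \<mu> (Poly_Mapping.lookup f \<mu>))" if "finite X" for X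
    using that by induction (simp_all add: assms(1), subst add.commute, rule assms(2))
  from this[of "Poly_Mapping.keys f"] show ?thesis
    by (simp add: poly_mapping_sum_single)
qed

lemma monomial_induct [case_names zero add]:
  assumes zero: "P 0" and add: "\<And>u v. P u \<Longrightarrow> P (u + Poly_Mapping.single v 1)"
  shows "P (u :: 'v \<Rightarrow>\<^sub>0 nat)"
proof (induction u rule: poly_mapping_induct_single)
  case zero
  show ?case by (fact assms)
next
  case (add f \<mu> c)
  show ?case
  proof (induction c)
    case 0
    then show ?case using add by simp
  next
    case (Suc c)
    have "Poly_Mapping.single \<mu> (Suc c) = Poly_Mapping.single \<mu> c + Poly_Mapping.single \<mu> 1"
      by (simp flip: single_add)
    then show ?case using assms(2)[OF Suc] by (simp add: add.assoc)
  qed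
qed

lemma monomial_decompose:
  assumes "v \<in> Poly_Mapping.keys (u :: 'v \<Rightarrow>\<^sub>0 nat)"
  obtains u' where "u = u' + Poly_Mapping.single v 1"
proof
  show "u = (u - Poly_Mapping.single v 1) + Poly_Mapping.single v 1"
    using assms by (intro poly_mapping_eqI) (auto simp: in_keys_iff lookup_add lookup_minus lookup_single when_def)
qed

lemma keys_mult_obtain:
  fixes f g :: "'b::comm_monoid_add \<Rightarrow>\<^sub>0 'a::semiring_0"
  assumes "\<kappa> \<in> Poly_Mapping.keys (f * g)"
  obtains a b where "\<kappa> = a + b" "a \<in> Poly_Mapping.keys f" "b \<in> Poly_Mapping.keys g"
  using keys_mult[of f g] assms by blast

section \<open>Additive maps on monomials\<close>

text \<open>Additive extension from variables to monomials. It serves for weights and degrees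
  (values in \<open>int\<close> and \<open>nat\<close>) as well as for monomial substitutions (the
  values are monomials); the inner sum stands for a multiple of \<open>\<tau> v\<close>, as the
  target is only a commutative monoid.\<close>

definition mext :: "('v \<Rightarrow> 'b::comm_monoid_add) \<Rightarrow> ('v \<Rightarrow>\<^sub>0 nat) \<Rightarrow> 'b" where
  "mext \<tau> u = (\<Sum>v\<in>Poly_Mapping.keys u. \<Sum>i<Poly_Mapping.lookup u v. \<tau> v)"

lemma sum_lessThan_add_const: "(\<Sum>i<a + b. c) = (\<Sum>i<a. c) + (\<Sum>i<(b::nat). c :: 'b::comm_monoid_add)"
  by (induction b) (auto simp: add.assoc)

lemma mext_superset:
  assumes "finite X" "Poly_Mapping.keys u \<subseteq> X"
  shows "mext \<tau> u = (\<Sum>v\<in>X. \<Sum>i<Poly_Mapping.lookup u v. \<tau> v)"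
  unfolding mext_def using assms by (intro sum.mono_neutral_left) (auto simp: in_keys_iff)

lemma mext_zero [simp]: "mext \<tau> 0 = 0"
  by (simp add: mext_def)

lemma mext_single [simp]: "mext \<tau> (Poly_Mapping.single v (Suc 0)) = \<tau> v"
  by (simp add: mext_def)

lemma mext_add: "mext \<tau> (u + u') = mext \<tau> u + mext \<tau> u'"
proof -
  let ?X = "Poly_Mapping.keys u \<union> Poly_Mapping.keys u'"
  have "mext \<tau> (u + u') = (\<Sum>v\<in>?X. \<Sum>i<Poly_Mapping.lookup (u + u') v. \<tau> v)"
    by (rule mext_superset) (auto simp: keys_add_nat)
  also have "\<dots> = mext \<tau> u + mext \<tau> u'"
    by (simp add: lookup_add sum_lessThan_add_const sum.distrib mext_superset[of ?X])
  finally show ?thesis .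
qed

lemma mext_cong:
  "(\<And>v. v \<in> Poly_Mapping.keys u \<Longrightarrow> \<tau> v = \<tau>' v) \<Longrightarrow> mext \<tau> u = mext \<tau>' u"
  unfolding mext_def by (auto intro!: sum.cong)

lemma lookup_mext: "Poly_Mapping.lookup (mext \<tau> u) x = mext (\<lambda>v. Poly_Mapping.lookup (\<tau> v) x) u"
  by (simp add: mext_def lookup_sum)

lemma mext_mext: "mext \<omega> (mext \<tau> u) = mext (\<lambda>v. mext \<omega> (\<tau> v)) u"
  by (induction u rule: monomial_induct) (simp_all add: mext_add)

lemma mext_nat:
  assumes "finite X" "Poly_Mapping.keys u \<subseteq> X"
  shows "mext \<tau> u = (\<Sum>v\<in>X. Poly_Mapping.lookup u v * \<tau> v :: nat)"
  by (simp add: mext_superset[OF assms])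

lemma mext_nat_pos:
  assumes "mext \<tau> u > (0::nat)"
  obtains v where "v \<in> Poly_Mapping.keys u" "\<tau> v > 0"
proof -
  have "(\<Sum>v\<in>Poly_Mapping.keys u. Poly_Mapping.lookup u v * \<tau> v) \<noteq> 0"
    using assms mext_nat[OF finite_keys subset_refl, of \<tau> u] by linarith
  then obtain v where "v \<in> Poly_Mapping.keys u" "Poly_Mapping.lookup u v * \<tau> v \<noteq> 0"
    by (rule sum.not_neutral_contains_not_neutral)
  then show ?thesis by (intro that[of v]) auto
qed

section \<open>Evaluation of polynomials\<close>

definition meval :: "('v \<Rightarrow> 'b::comm_monoid_mult) \<Rightarrow> ('v \<Rightarrow>\<^sub>0 nat) \<Rightarrow> 'b" where
  "meval \<phi> u = (\<Prod>v\<in>Poly_Mapping.keys u. \<phi> v ^ Poly_Mapping.lookup u v)"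

lemma meval_superset:
  assumes "finite X" "Poly_Mapping.keys u \<subseteq> X"
  shows "meval \<phi> u = (\<Prod>v\<in>X. \<phi> v ^ Poly_Mapping.lookup u v)"
  unfolding meval_def using assms by (intro prod.mono_neutral_left) (auto simp: in_keys_iff)

lemma meval_zero [simp]: "meval \<phi> 0 = 1"
  by (simp add: meval_def)

lemma meval_single [simp]: "meval \<phi> (Poly_Mapping.single v (Suc 0)) = \<phi> v"
  by (simp add: meval_def)

lemma meval_add: "meval \<phi> (u + u') = meval \<phi> u * meval \<phi> u'"
proof -
  let ?X = "Poly_Mapping.keys u \<union> Poly_Mapping.keys u'"
  have "meval \<phi> (u + u') = (\<Prod>v\<in>?X. \<phi> v ^ Poly_Mapping.lookup (u + u') v)"
    by (rule meval_superset) (auto simp: keys_add_nat)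
  also have "\<dots> = meval \<phi> u * meval \<phi> u'"
    by (simp add: lookup_add power_add prod.distrib meval_superset[of ?X])
  finally show ?thesis .
qed

definition peval :: "('v \<Rightarrow> ('w, 'a) mpoly) \<Rightarrow> ('v, 'a::comm_ring_1) mpoly \<Rightarrow> ('w, 'a) mpoly" where
  "peval \<phi> f = (\<Sum>\<mu>\<in>Poly_Mapping.keys f. Poly_Mapping.single 0 (Poly_Mapping.lookup f \<mu>) * meval \<phi> \<mu>)"

lemma peval_superset:
  assumes "finite X" "Poly_Mapping.keys f \<subseteq> X"
  shows "peval \<phi> f = (\<Sum>\<mu>\<in>X. Poly_Mapping.single 0 (Poly_Mapping.lookup f \<mu>) * meval \<phi> \<mu>)"
  unfolding peval_def using assms by (intro sum.mono_neutral_left) (auto simp: in_keys_iff)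

lemma peval_zero [simp]: "peval \<phi> 0 = 0"
  by (simp add: peval_def)

lemma peval_add: "peval \<phi> (f + g) = peval \<phi> f + peval \<phi> g"
proof -
  let ?X = "Poly_Mapping.keys f \<union> Poly_Mapping.keys g"
  have "peval \<phi> (f + g) = (\<Sum>\<mu>\<in>?X. Poly_Mapping.single 0 (Poly_Mapping.lookup (f + g) \<mu>) * meval \<phi> \<mu>)"
    by (rule peval_superset) (use keys_add[of f g] in auto)
  also have "\<dots> = peval \<phi> f + peval \<phi> g"
    by (simp add: lookup_add single_add distrib_right sum.distrib peval_superset[of ?X])
  finally show ?thesis .
qed

lemma peval_uminus: "peval \<phi> (- f) = - peval \<phi> f"
  using peval_add[of \<phi> f "- f"] by (simp add: eq_neg_iff_add_eq_0 add.commute)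

lemma peval_diff: "peval \<phi> (f - g) = peval \<phi> f - peval \<phi> g"
  using peval_add[of \<phi> f "- g"] by (simp add: peval_uminus)

lemma peval_single: "peval \<phi> (Poly_Mapping.single \<mu> c) = Poly_Mapping.single 0 c * meval \<phi> \<mu>"
  by (cases "c = 0") (simp_all add: peval_def)

lemma peval_mult_single:
  fixes \<phi> :: "'v \<Rightarrow> ('w, 'a::comm_ring_1) mpoly"
  shows "peval \<phi> (f * Poly_Mapping.single \<mu> c) = peval \<phi> f * peval \<phi> (Poly_Mapping.single \<mu> c)"
proof (induction f rule: poly_mapping_induct_single)
  case (add f \<nu> d)
  have "peval \<phi> (Poly_Mapping.single \<nu> d * Poly_Mapping.single \<mu> c)
      = Poly_Mapping.single 0 (d * c) * (meval \<phi> \<nu> * meval \<phi> \<mu>)"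
    by (simp add: mult_single peval_single meval_add)
  also have "Poly_Mapping.single 0 (d * c) = Poly_Mapping.single 0 d * (Poly_Mapping.single 0 c :: ('w, 'a) mpoly)"
    by (simp add: mult_single)
  finally have "peval \<phi> (Poly_Mapping.single \<nu> d * Poly_Mapping.single \<mu> c)
      = peval \<phi> (Poly_Mapping.single \<nu> d) * peval \<phi> (Poly_Mapping.single \<mu> c)"
    by (simp only: peval_single mult_ac)
  then show ?case
    using add by (simp add: distrib_right peval_add)
qed simp

lemma peval_mult: "peval \<phi> (f * g) = peval \<phi> f * peval \<phi> g"
  by (induction g rule: poly_mapping_induct_single) (simp_all add: distrib_left peval_add peval_mult_single)

lemma peval_one [simp]: "peval \<phi> 1 = 1"
  using peval_single[of \<phi> 0 1] by simp

lemma peval_Var [simp]: "peval \<phi> (Var v) = \<phi> v"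
  unfolding Var_def by (simp add: peval_single)

lemma peval_prod: "peval \<phi> (prod f X) = (\<Prod>x\<in>X. peval \<phi> (f x))"
  by (induction X rule: infinite_finite_induct) (simp_all add: peval_mult)

lemma meval_monomials:
  assumes "\<And>v. v \<in> Poly_Mapping.keys u \<Longrightarrow> \<phi> v = Poly_Mapping.single (\<tau> v) 1"
  shows "meval \<phi> u = (Poly_Mapping.single (mext \<tau> u) 1 :: ('w, 'a::comm_ring_1) mpoly)"
  using assms by (induction u rule: monomial_induct) (auto simp: meval_add mext_add mult_single keys_add_nat)

section \<open>Leading monomials with respect to a weight\<close>

text \<open>A weight replaces a monomial order here, so ties have to be excluded: the top form is a
  single monomial with coefficient 1.\<close>

definition led_by :: "('v \<Rightarrow> int) \<Rightarrow> ('v, 'a::comm_ring_1) mpoly \<Rightarrow> ('v \<Rightarrow>\<^sub>0 nat) \<Rightarrow> bool" where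
  "led_by \<omega> p \<kappa> \<longleftrightarrow> Poly_Mapping.lookup p \<kappa> = 1 \<and>
     (\<forall>\<kappa>'\<in>Poly_Mapping.keys p. \<kappa>' \<noteq> \<kappa> \<longrightarrow> mext \<omega> \<kappa>' < mext \<omega> \<kappa>)"

lemma led_by_single: "led_by \<omega> (Poly_Mapping.single \<kappa> 1) \<kappa>"
  by (simp add: led_by_def)

lemma led_by_single_add:
  assumes "\<And>\<kappa>'. \<kappa>' \<in> Poly_Mapping.keys q \<Longrightarrow> mext \<omega> \<kappa>' < mext \<omega> \<kappa>"
  shows "led_by \<omega> (Poly_Mapping.single \<kappa> 1 + q) \<kappa>"
proof -
  have "Poly_Mapping.lookup q \<kappa> = 0"
    using assms[of \<kappa>] by (auto simp: in_keys_iff)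
  then show ?thesis
    using assms keys_add[of "Poly_Mapping.single \<kappa> 1" q] by (auto simp: led_by_def lookup_add)
qed

lemma led_by_keys:
  assumes "led_by \<omega> (p :: ('v, 'a::comm_ring_1) mpoly) \<kappa>" 
  shows "Poly_Mapping.keys (p - Poly_Mapping.single \<kappa> 1) \<subseteq> {\<kappa>'. mext \<omega> \<kappa>' < mext \<omega> \<kappa>}"
  using assms by (auto simp: led_by_def in_keys_iff lookup_minus lookup_single when_def split: if_splits)

text \<open>Split each factor into its leader and a lighter rest; every product that involves a rest
  is lighter than the product of the leaders.\<close>

lemma led_by_mult:
  assumes "led_by \<omega> p \<kappa>" "led_by \<omega> q \<nu>"
  shows "led_by \<omega> (p * q) (\<kappa> + \<nu>)"
proof -
  define p' where "p' = p - Poly_Mapping.single \<kappa> 1"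
  define q' where "q' = q - Poly_Mapping.single \<nu> 1"
  have p': "mext \<omega> x < mext \<omega> \<kappa>" if "x \<in> Poly_Mapping.keys p'" for x
    using led_by_keys[OF assms(1)] that by (auto simp: p'_def)
  have q': "mext \<omega> x < mext \<omega> \<nu>" if "x \<in> Poly_Mapping.keys q'" for x
    using led_by_keys[OF assms(2)] that by (auto simp: q'_def)
  have "p * q = Poly_Mapping.single (\<kappa> + \<nu>) 1
      + (Poly_Mapping.single \<kappa> 1 * q' + p' * Poly_Mapping.single \<nu> 1 + p' * q')"
    by (simp add: p'_def q'_def algebra_simps mult_single)
  moreover have "mext \<omega> x < mext \<omega> (\<kappa> + \<nu>)"
    if "x \<in> Poly_Mapping.keys (Poly_Mapping.single \<kappa> 1 * q' + p' * Poly_Mapping.single \<nu> 1 + p' * q')" for x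
  proof -
    have "x \<in> Poly_Mapping.keys (Poly_Mapping.single \<kappa> 1 * q') \<union> Poly_Mapping.keys (p' * Poly_Mapping.single \<nu> 1)
        \<union> Poly_Mapping.keys (p' * q')"
      using subsetD[OF keys_add that] keys_add[of "Poly_Mapping.single \<kappa> 1 * q'" "p' * Poly_Mapping.single \<nu> 1"]
      by auto
    then consider (1) b where "x = \<kappa> + b" "b \<in> Poly_Mapping.keys q'"
      | (2) a where "x = a + \<nu>" "a \<in> Poly_Mapping.keys p'"
      | (3) a b where "x = a + b" "a \<in> Poly_Mapping.keys p'" "b \<in> Poly_Mapping.keys q'"
      by (auto elim!: keys_mult_obtain)
    then show ?thesis
    proof cases
      case 1
      then show ?thesis using q' by (simp add: mext_add)
    next
      case 2
      then show ?thesis using p' by (simp add: mext_add)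
    next
      case 3
      then show ?thesis using add_strict_mono[OF p' q'] by (simp add: mext_add)
    qed
  qed
  ultimately show ?thesis
    using led_by_single_add[of _ \<omega> "\<kappa> + \<nu>"] by metis
qed

lemma led_by_meval:
  assumes "\<And>v. v \<in> Poly_Mapping.keys u \<Longrightarrow> led_by \<omega> (\<phi> v) (\<tau> v)"
  shows "led_by \<omega> (meval \<phi> u) (mext \<tau> u)"
  using assms
proof (induction u rule: monomial_induct)
  case zero
  then show ?case using led_by_single[of \<omega> 0] by simp
next
  case (add u v)
  then show ?case by (auto simp: meval_add mext_add keys_add_nat intro!: led_by_mult)
qed

text \<open>Over a top-weight monomial of \<open>f\<close> nothing can cancel, because distinct monomials
  have distinct leading monomials.\<close>

lemma lookup_peval_led_by:
  assumes led: "\<And>\<mu> v. \<mu> \<in> Poly_Mapping.keys f \<Longrightarrow> v \<in> Poly_Mapping.keys \<mu> \<Longrightarrow> led_by \<omega> (\<phi> v) (\<tau> v)"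
    and max: "\<And>\<mu>. \<mu> \<in> Poly_Mapping.keys f \<Longrightarrow> mext \<omega> (mext \<tau> \<mu>) \<le> mext \<omega> (mext \<tau> u)"
    and inj: "\<And>\<mu>. \<mu> \<in> Poly_Mapping.keys f \<Longrightarrow> mext \<tau> \<mu> = mext \<tau> u \<Longrightarrow> \<mu> = u"
    and u: "u \<in> Poly_Mapping.keys f"
  shows "Poly_Mapping.lookup (peval \<phi> f) (mext \<tau> u) = Poly_Mapping.lookup f u"
proof -
  have *: "Poly_Mapping.lookup (meval \<phi> \<mu>) (mext \<tau> u) = (if \<mu> = u then 1 else 0)"
    if "\<mu> \<in> Poly_Mapping.keys f" for \<mu>
  proof -
    have "led_by \<omega> (meval \<phi> \<mu>) (mext \<tau> \<mu>)"
      using led[OF that] by (rule led_by_meval)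
    \<comment> \<open>Monomials of \<open>meval \<phi> \<mu>\<close> weigh at most as much as its
      leader, which by \<open>max\<close> is no heavier than \<open>mext \<tau> u\<close>; so
      \<open>mext \<tau> u\<close> can occur only as the leader itself.\<close>
    then have "mext \<tau> u = mext \<tau> \<mu>" if "mext \<tau> u \<in> Poly_Mapping.keys (meval \<phi> \<mu>)"
      using max[OF \<open>\<mu> \<in> Poly_Mapping.keys f\<close>] that by (force simp: led_by_def)
    then show ?thesis
      using inj[OF that] \<open>led_by \<omega> (meval \<phi> \<mu>) (mext \<tau> \<mu>)\<close> by (auto simp: led_by_def in_keys_iff)
  qed
  have "Poly_Mapping.lookup (peval \<phi> f) (mext \<tau> u)
      = (\<Sum>\<mu>\<in>Poly_Mapping.keys f. Poly_Mapping.lookup f \<mu> * Poly_Mapping.lookup (meval \<phi> \<mu>) (mext \<tau> u))"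
    by (simp add: peval_def lookup_sum flip: mult_map_scale_conv_mult, 
        auto simp: Poly_Mapping.map.rep_eq when_def intro!: sum.cong)
  also have "\<dots> = Poly_Mapping.lookup f u"
    using u by (simp add: * if_distrib[of "(*) _"] cong: sum.cong if_cong)
  finally show ?thesis .
qed

section \<open>Order of vanishing along a variable\<close>

text \<open>The ideal generated by the \<open>t\<close>-th power of the variable
  \<open>e\<close>.\<close>

definition vanish :: "'v \<Rightarrow> nat \<Rightarrow> ('v, 'a::comm_ring_1) mpoly set" where
  "vanish e t = {p. \<forall>\<kappa>\<in>Poly_Mapping.keys p. t \<le> Poly_Mapping.lookup \<kappa> e}"

lemma vanish_zero [simp]: "0 \<in> vanish e t"
  by (simp add: vanish_def)

lemma vanish_0 [simp]: "p \<in> vanish e 0"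
  by (simp add: vanish_def)

lemma vanish_add: "p \<in> vanish e t \<Longrightarrow> q \<in> vanish e t \<Longrightarrow> p + q \<in> vanish e t"
  unfolding vanish_def using keys_add[of p q] by blast

lemma vanish_uminus: "p \<in> vanish e t \<Longrightarrow> - p \<in> vanish e t"
  by (simp add: vanish_def keys_uminus_pm)

lemma vanish_diff: "p \<in> vanish e t \<Longrightarrow> q \<in> vanish e t \<Longrightarrow> p - q \<in> vanish e t"
  using vanish_add[of p e t "- q"] by (simp add: vanish_uminus)

lemma vanish_mult: "p \<in> vanish e s \<Longrightarrow> q \<in> vanish e t \<Longrightarrow> p * q \<in> vanish e (s + t)"
  unfolding vanish_def by (auto elim!: keys_mult_obtain simp: lookup_add add_mono)

lemma vanish_mult_left: "q \<in> vanish e t \<Longrightarrow> p * q \<in> vanish e t"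
  using vanish_mult[of p e 0 q t] by simp

lemma vanish_sum: "(\<And>x. x \<in> X \<Longrightarrow> f x \<in> vanish e t) \<Longrightarrow> sum f X \<in> vanish e t"
  by (induction X rule: infinite_finite_induct) (auto simp: vanish_add)

text \<open>\<open>vanish e t\<close> is an ideal, so congruence modulo it is kept by sums and
  products.\<close>

lemma vanish_peval_diff:
  assumes "\<And>v. \<phi> v - \<psi> v \<in> vanish e t"
  shows "peval \<phi> f - peval \<psi> f \<in> vanish e t"
proof -
  have *: "meval \<phi> u - meval \<psi> u \<in> vanish e t" for u
  proof (induction u rule: monomial_induct)
    case (add u v)
    have "meval \<phi> (u + Poly_Mapping.single v 1) - meval \<psi> (u + Poly_Mapping.single v 1)
       = \<phi> v * (meval \<phi> u - meval \<psi> u) + meval \<psi> u * (\<phi> v - \<psi> v)"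
      by (simp add: meval_add algebra_simps)
    then show ?case
      using add assms by (auto intro!: vanish_add vanish_mult_left)
  qed simp
  have "peval \<phi> f - peval \<psi> f
      = (\<Sum>\<mu>\<in>Poly_Mapping.keys f. Poly_Mapping.single 0 (Poly_Mapping.lookup f \<mu>) * (meval \<phi> \<mu> - meval \<psi> \<mu>))"
    by (simp add: peval_def right_diff_distrib sum_subtractf)
  then show ?thesis
    by (simp add: vanish_sum vanish_mult_left *)
qed

definition slice :: "'v \<Rightarrow> nat \<Rightarrow> ('v, 'a::comm_ring_1) mpoly \<Rightarrow> ('v, 'a) mpoly" where
  "slice e d p = (\<Sum>\<kappa> | \<kappa> \<in> Poly_Mapping.keys p \<and> Poly_Mapping.lookup \<kappa> e = d. 
     Poly_Mapping.single \<kappa> (Poly_Mapping.lookup p \<kappa>))"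

lemma lookup_slice:
  "Poly_Mapping.lookup (slice e d p) \<kappa> = (if Poly_Mapping.lookup \<kappa> e = d then Poly_Mapping.lookup p \<kappa> else 0)"
proof -
  have "Poly_Mapping.lookup (slice e d p) \<kappa> = (\<Sum>\<mu> | \<mu> \<in> Poly_Mapping.keys p \<and> Poly_Mapping.lookup \<mu> e = d. 
     (if \<mu> = \<kappa> then Poly_Mapping.lookup p \<kappa> else 0))"
    by (auto simp: slice_def lookup_sum lookup_single when_def intro!: sum.cong)
  then show ?thesis by (auto simp: sum.delta in_keys_iff)
qed

lemma slice_keys: "\<kappa> \<in> Poly_Mapping.keys (slice e d p) \<Longrightarrow> Poly_Mapping.lookup \<kappa> e = d"
  by (auto simp: in_keys_iff lookup_slice split: if_splits)

lemma diff_slice_vanish: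
  assumes "p \<in> vanish e d"
  shows "p - slice e d p \<in> vanish e (Suc d)"
  using assms unfolding vanish_def
  by (auto simp: in_keys_iff lookup_minus lookup_slice Suc_le_eq order_less_le split: if_splits)

lemma slice_nonzero:
  assumes "p \<in> vanish e d" "p \<notin> vanish e (Suc d)"
  shows "slice e d p \<noteq> 0"
  using diff_slice_vanish[OF assms(1)] assms(2) by auto

text \<open>The hypothesis on \<open>p\<close> says that the variable \<open>e\<close>, a prime element, does not divide \<open>p\<close>.\<close>

lemma vanish_cancel:
  fixes p q :: "('v::linorder, 'a::idom) mpoly"
  assumes pq: "p * q \<in> vanish e t" and p: "p \<notin> vanish e 1"
  shows "q \<in> vanish e t"
proof (rule ccontr)
  assume "q \<notin> vanish e t"
  then obtain d where d: "d < t" "q \<in> vanish e d" "q \<notin> vanish e (Suc d)"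
  proof (induction t)
    case (Suc t)
    then show ?case by (cases "q \<in> vanish e t") (auto intro: less_SucI)
  qed simp
  let ?p = "slice e 0 p" and ?q = "slice e d q"
  \<comment> \<open>\<open>d\<close> is the exact order of \<open>q\<close> along \<open>e\<close>,
    and that of \<open>p\<close> is 0. The lowest components have a nonzero product, as the
    polynomial ring is a domain; so \<open>p * q\<close> would have order
    \<open>d < t\<close>.\<close>
  have "?p * ?q \<noteq> 0"
    using slice_nonzero[of p e 0] slice_nonzero[of q e d] p d by simp
  then obtain \<kappa> where \<kappa>: "\<kappa> \<in> Poly_Mapping.keys (?p * ?q)"
    by (metis ex_in_conv keys_eq_empty)
  then have \<kappa>e: "Poly_Mapping.lookup \<kappa> e = d"
    by (auto elim!: keys_mult_obtain simp: lookup_add dest!: slice_keys)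
  have "p * q - ?p * ?q = (p - ?p) * q + ?p * (q - ?q)"
    by (simp add: algebra_simps)
  also have "\<dots> \<in> vanish e (Suc d)"
    using vanish_mult[of "p - ?p" e 1 q d] diff_slice_vanish[of p e 0] diff_slice_vanish[of q e d] d
    by (auto intro!: vanish_add vanish_mult_left)
  finally have "p * q - ?p * ?q \<in> vanish e (Suc d)" .
  moreover have "p * q \<in> vanish e (Suc d)"
    using pq d by (auto simp: vanish_def)
  ultimately have "?p * ?q \<in> vanish e (Suc d)"
    using vanish_diff[of "p * q" e "Suc d" "p * q - ?p * ?q"] by simp
  then show False using \<kappa> \<kappa>e by (auto simp: vanish_def)
qed

section \<open>Weighted bipartite covers\<close>

definition vcover :: "('v \<times> 'v) set \<Rightarrow> 'v set \<Rightarrow> bool" where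
  "vcover E C \<longleftrightarrow> (\<forall>(a, b)\<in>E. a \<in> C \<or> b \<in> C)"

text \<open>The step from \<open>t\<close> to \<open>t + 1\<close> of the weighted Koenig theorem. Covers of minimum weight are closed
  under \<open>(A \<inter> A', B \<union> B')\<close> and \<open>(A \<union> A', B \<inter> B')\<close>; the edge starts in a minimal \<open>A\<close>-part of such a cover.\<close>

lemma konig_step:
  fixes u :: "'v \<Rightarrow> nat"
  assumes fin: "finite V" and E: "E \<subseteq> (V \<inter> A) \<times> (V - A)"
    and heavy: "\<And>C. C \<subseteq> V \<Longrightarrow> vcover E C \<Longrightarrow> Suc t \<le> sum u C"
  obtains a b where "(a, b) \<in> E" "u a > 0" "u b > 0"
    "\<And>C. C \<subseteq> V \<Longrightarrow> vcover E C \<Longrightarrow> a \<in> C \<Longrightarrow> b \<in> C \<Longrightarrow> Suc (Suc t) \<le> sum u C"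
proof -
  define Z where "Z = {v \<in> V. u v = 0}"
  define tight where "tight C \<longleftrightarrow> C \<subseteq> V \<and> vcover E C \<and> sum u C = Suc t" for C
  define S where "S C = {v \<in> C \<inter> A. u v > 0}" for C
  have finC: "finite C" if "C \<subseteq> V" for C
    using that fin by (rule finite_subset)
  \<comment> \<open>Trading a vertex of positive weight for the weightless set \<open>Z\<close>
    makes a tight cover lighter than \<open>heavy\<close> allows for covers.\<close>
  have drop: "\<not> vcover E (C - {v} \<union> Z)" if "tight C" "v \<in> C" "u v > 0" for C v
  proof
    assume "vcover E (C - {v} \<union> Z)"
    moreover have "C - {v} \<union> Z \<subseteq> V"
      using that by (auto simp: tight_def Z_def)
    ultimately have "Suc t \<le> sum u (C - {v} \<union> Z)" by (intro heavy)
    also have "\<dots> = sum u (C - {v})"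
      using that fin finC by (intro sum.mono_neutral_right) (auto simp: tight_def Z_def)
    also have "\<dots> < sum u C"
      using that finC[of C] by (simp add: tight_def sum.remove)
    finally show False using that by (simp add: tight_def)
  qed
  show thesis
  proof (cases "\<exists>C. tight C \<and> S C \<noteq> {}")
    case False
    \<comment> \<open>Here any edge with both ends of positive weight works: a cover through
      \<open>a\<close> has positive weight in \<open>A\<close>, and no tight cover has.\<close>
    have "\<not> vcover E Z"
      using heavy[of Z] by (auto simp: Z_def)
    then obtain a b where ab: "(a, b) \<in> E" "a \<notin> Z" "b \<notin> Z"
      by (auto simp: vcover_def)
    show thesis
    proof (rule that[of a b])
      fix C assume C: "C \<subseteq> V" "vcover E C" "a \<in> C" "b \<in> C"
      then have "\<not> tight C"
        using False ab E by (auto simp: S_def Z_def)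
      then show "Suc (Suc t) \<le> sum u C"
        using C heavy[of C] by (auto simp: tight_def)
    qed (use ab E in \<open>auto simp: Z_def\<close>)
  next
    case True
    have fS: "finite (S C)" if "tight C" for C
      using that finC by (auto simp: tight_def S_def)
    define C0 where "C0 = arg_min (\<lambda>C. card (S C)) (\<lambda>C. tight C \<and> S C \<noteq> {})"
    have C0: "tight C0" "S C0 \<noteq> {}"
      and min: "\<And>C. tight C \<Longrightarrow> S C \<noteq> {} \<Longrightarrow> card (S C0) \<le> card (S C)"
      unfolding C0_def using True
      by (metis (mono_tags, lifting) arg_min_nat_lemma)+
    then obtain a where a: "a \<in> C0" "a \<in> A" "u a > 0"
      by (auto simp: S_def)
    obtain b where b: "(a, b) \<in> E" "b \<notin> C0" "u b > 0"
    proof -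
      \<comment> \<open>Removing \<open>a\<close> uncovers an edge; it must start at
        \<open>a\<close>, and its other end is outside \<open>C0\<close>.\<close>
      obtain x y where xy: "(x, y) \<in> E" "x \<notin> C0 - {a} \<union> Z" "y \<notin> C0 - {a} \<union> Z"
        using drop[OF C0(1) a(1,3)] by (auto simp: vcover_def)
      have "x \<in> C0 \<or> y \<in> C0"
        using C0(1) xy(1) by (auto simp: tight_def vcover_def)
      then have "x = a" "y \<notin> C0"
        using xy a E by auto
      then show thesis
        using that[of y] xy E by (auto simp: Z_def)
    qed
    show thesis
    proof (rule that[of a b])
      fix C assume C: "C \<subseteq> V" "vcover E C" "a \<in> C" "b \<in> C"
      show "Suc (Suc t) \<le> sum u C"
      proof (rule ccontr)
        assume "\<not> ?thesis"
        then have tC: "tight C"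
          using C heavy[of C] by (auto simp: tight_def)
        define M where "M = (C \<inter> C0 \<inter> A) \<union> ((C \<union> C0) - A)"
        define L where "L = ((C \<union> C0) \<inter> A) \<union> (C \<inter> C0 - A)"
        have sub: "M \<subseteq> V" "L \<subseteq> V"
          using C0 C by (auto simp: M_def L_def tight_def)
        have "vcover E M" "vcover E L"
          using C0(1) C E unfolding vcover_def M_def L_def tight_def by blast+
        then have ge: "Suc t \<le> sum u M" "Suc t \<le> sum u L"
          using heavy sub by auto
        have "sum u M + sum u L = sum u (M \<union> L) + sum u (M \<inter> L)"
          using sub finC by (simp add: sum.union_inter)
        also have "M \<union> L = C \<union> C0" by (auto simp: M_def L_def)
        also have "M \<inter> L = C \<inter> C0" by (auto simp: M_def L_def)
        also have "sum u (C \<union> C0) + sum u (C \<inter> C0) = sum u C + sum u C0"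
          using C C0 finC by (simp add: sum.union_inter tight_def)
        also have "\<dots> = Suc t + Suc t"
          using tC C0 by (simp add: tight_def)
        finally have eq: "sum u M = Suc t" "sum u L = Suc t"
          using ge by linarith+
        have "tight M"
          using \<open>vcover E M\<close> sub eq by (simp add: tight_def)
        moreover have "a \<in> S M"
          using a C by (auto simp: S_def M_def)
        ultimately have "card (S C0) \<le> card (S M)"
          using min by blast
        moreover have "S M \<subseteq> S C0" by (auto simp: S_def M_def)
        ultimately have "S M = S C0"
          using fS[OF C0(1)] by (metis card_seteq)
        \<comment> \<open>By minimality \<open>C\<close> contains the positive \<open>A\<close>-part
          of \<open>C0\<close>, so \<open>L\<close> lies in \<open>C\<close> up to weight 0. It
          misses \<open>b\<close>, which is in \<open>C\<close> and has positive weight, so it would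
          be lighter than \<open>C\<close>, although both are tight.\<close>
        then have "L - C \<subseteq> Z"
          using sub by (auto simp: S_def M_def L_def Z_def)
        have "b \<notin> L" using b E by (auto simp: L_def)
        have "sum u L \<le> sum u (C \<union> Z - {b})"
          using \<open>L - C \<subseteq> Z\<close> \<open>b \<notin> L\<close> finC[OF C(1)] fin by (intro sum_mono2) (auto simp: Z_def)
        also have "\<dots> < sum u (C \<union> Z)"
          using C b finC[OF C(1)] fin by (simp add: Z_def sum.remove[of _ b])
        also have "\<dots> = sum u C"
          using C fin finC by (intro sum.mono_neutral_right) (auto simp: Z_def)
        finally show False
          using eq tC by (simp add: tight_def)
      qed
    qed (use a b in auto)
  qed
qed

section \<open>Independent sets and descending paths\<close>

text \<open>\<open>steps m n T c\<close>: the columns in \<open>T\<close> separate \<open>{1..n}\<close> into blocks, and inside each block \<open>c\<close> is the row at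
  which a lattice path from row \<open>m\<close> to row \<open>1\<close> passes from column \<open>k\<close> to column \<open>k + 1\<close>.\<close>

definition cuts :: "nat \<Rightarrow> nat set \<Rightarrow> bool" where
  "cuts n T \<longleftrightarrow> T \<subseteq> {2..n - 1} \<and> (\<forall>k\<in>T. Suc k \<notin> T)"

definition steps :: "nat \<Rightarrow> nat \<Rightarrow> nat set \<Rightarrow> (nat \<Rightarrow> nat) \<Rightarrow> bool" where
  "steps m n T c \<longleftrightarrow> c 0 = m \<and> c n = 1 \<and> (\<forall>k\<in>T. c k = m \<and> c (k - 1) = 1) \<and>
     (\<forall>k\<in>{1..n} - T. c k \<le> c (k - 1))"

definition lattice_path :: "nat set \<Rightarrow> (nat \<Rightarrow> nat) \<Rightarrow> (nat \<times> nat) set" where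
  "lattice_path T c = {(r, k). k \<notin> T \<and> c k \<le> r \<and> r \<le> c (k - 1)}"

text \<open>Greedy choice ensures that every empty inner column is cut or directly follows a
  cut.\<close>

primrec greedy_cut :: "(nat \<Rightarrow> nat set) \<Rightarrow> nat \<Rightarrow> nat \<Rightarrow> bool" where
  "greedy_cut Z n 0 = False"
| "greedy_cut Z n (Suc k) = (0 < k \<and> Suc k < n \<and> Z (Suc k) = {} \<and> \<not> greedy_cut Z n k)"

text \<open>By \<open>indep\<close>, rows weakly decrease from each column to the next, so cells in
  consecutive nonempty columns fit on one descending path. Only across an empty column may the rows
  rise again, and there a cut lets the path restart in row \<open>m\<close>.\<close>

lemma independent_subset_lattice_path:
  fixes Z :: "nat \<Rightarrow> nat set"
  assumes n: "n \<ge> 2" and Z: "\<And>k. Z k \<subseteq> {1..m}"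
    and out: "Z 0 = {}" "\<And>k. k > n \<Longrightarrow> Z k = {}" and m: "m \<ge> 1"
    and indep: "\<And>k i j. i \<in> Z k \<Longrightarrow> j \<in> Z (Suc k) \<Longrightarrow> j \<le> i"
  obtains T c where "cuts n T" "steps m n T c" "(\<Union>k. Z k \<times> {k}) \<subseteq> lattice_path T c"
proof -
  define T where "T = {k. greedy_cut Z n k}"
  \<comment> \<open>The path leaves column \<open>k\<close> at the largest row that column
    \<open>k + 1\<close> needs. The value \<open>m\<close> restarts it after a cut; the default 1 is
    taken only directly before a cut or from column \<open>n - 1\<close> on.\<close>
  define c where "c k = (if k = 0 \<or> k \<in> T then m else if Z (Suc k) = {} then 1 else Max (Z (Suc k)))" for k
  have T: "Suc k \<in> T \<longleftrightarrow> 0 < k \<and> Suc k < n \<and> Z (Suc k) = {} \<and> k \<notin> T" for k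
    by (simp add: T_def)
  have T0: "0 \<notin> T" by (simp add: T_def)
  have T': "k \<in> T \<Longrightarrow> 1 < k \<and> k < n \<and> Z k = {} \<and> k - 1 \<notin> T" for k
    using T[of "k - 1"] T0 by (cases k) auto
  have fin: "finite (Z k)" for k
    using finite_subset[OF Z[of k]] by simp
  have Max_in: "Max (Z k) \<in> Z k" if "Z k \<noteq> {}" for k
    using fin that by (rule Max_in)
  have range: "1 \<le> c k" "c k \<le> m" for k
    using Max_in[of "Suc k"] Z[of "Suc k"] m by (force simp: c_def)+
  have Zc: "r \<le> c (k - 1)" if "r \<in> Z k" for r k
  proof -
    have "k \<noteq> 0" using that out by (cases k) auto
    moreover have "r \<le> m" using that Z[of k] by auto
    ultimately show ?thesis using that fin[of k] by (auto simp: c_def)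
  qed
  have cZ: "c k \<le> r" if "r \<in> Z k" for r k
  proof -
    have "k \<noteq> 0" "k \<notin> T" using that out T'[of k] by (cases k; auto)+
    moreover have "1 \<le> r" using that Z[of k] by auto
    ultimately show ?thesis
      using that indep[OF that, of "Max (Z (Suc k))"] Max_in[of "Suc k"] by (auto simp: c_def)
  qed
  have "cuts n T"
    unfolding cuts_def
  proof (intro conjI subsetI ballI notI)
    fix k assume "k \<in> T"
    from T'[OF this] show "k \<in> {2..n - 1}" by auto
  next
    fix k assume "k \<in> T" "Suc k \<in> T"
    with T[of k] show False by simp
  qed
  moreover have "steps m n T c"
    unfolding steps_def
  proof (intro conjI ballI)
    show "c 0 = m" by (simp add: c_def)
    show "c n = 1" using n out T'[of n] by (auto simp: c_def)
  next
    fix k assume "k \<in> T"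
    then show "c k = m" by (simp add: c_def)
    from T'[OF \<open>k \<in> T\<close>] show "c (k - 1) = 1" by (auto simp: c_def)
  next
    fix k assume k: "k \<in> {1..n} - T"
    show "c k \<le> c (k - 1)"
    proof (cases "Z k = {}")
      case False
      then show ?thesis using cZ Zc Max_in order_trans by blast
    next
      case True
      show ?thesis
      proof (cases "k - 1 = 0 \<or> k - 1 \<in> T")
        case True
        then show ?thesis using range[of k] by (simp add: c_def)
      next
        case False
        \<comment> \<open>An empty column that is neither cut nor preceded by a cut or the left
          border is the last one, and \<open>c n = 1\<close>.\<close>
        then have "k = n"
          using k True T[of "k - 1"] by auto
        then show ?thesis using k out range[of "k - 1"] by (simp add: c_def)
      qed
    qed
  qed
  moreover have "(\<Union>k. Z k \<times> {k}) \<subseteq> lattice_path T c"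
    using cZ Zc T' by (fastforce simp: lattice_path_def)
  ultimately show thesis by (rule that)
qed

section \<open>The polynomial ring and the ideal of adjacent minors\<close>

definition minor :: "nat \<Rightarrow> nat \<Rightarrow> nat \<Rightarrow> nat \<Rightarrow> (nat \<times> nat, 'a::comm_ring_1) mpoly" where
  "minor k l i j = Var (i, k) * Var (j, l) - Var (i, l) * Var (j, k)"

lemma polyS_iff_keys: "f \<in> polyS m n \<longleftrightarrow> (\<forall>\<mu>\<in>Poly_Mapping.keys f. Poly_Mapping.keys \<mu> \<subseteq> {1..m} \<times> {1..n})"
  by (simp add: polyS_def)

lemma polyS_add: "f \<in> polyS m n \<Longrightarrow> g \<in> polyS m n \<Longrightarrow> f + g \<in> polyS m n"
  unfolding polyS_iff_keys using keys_add[of f g] by blast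

lemma polyS_uminus: "f \<in> polyS m n \<Longrightarrow> - f \<in> polyS m n"
  by (simp add: polyS_iff_keys keys_uminus_pm)

lemma polyS_mult:
  assumes "f \<in> polyS m n" "g \<in> polyS m n"
  shows "f * g \<in> polyS m n"
  unfolding polyS_iff_keys
proof
  fix \<mu> assume "\<mu> \<in> Poly_Mapping.keys (f * g)"
  then obtain a b where "\<mu> = a + b" "a \<in> Poly_Mapping.keys f" "b \<in> Poly_Mapping.keys g"
    by (rule keys_mult_obtain)
  then show "Poly_Mapping.keys \<mu> \<subseteq> {1..m} \<times> {1..n}"
    using assms by (simp add: polyS_iff_keys keys_add_nat)
qed

lemma polyS_single: "Poly_Mapping.keys \<mu> \<subseteq> {1..m} \<times> {1..n} \<Longrightarrow> Poly_Mapping.single \<mu> c \<in> polyS m n"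
  by (simp add: polyS_iff_keys)

lemma subring_polyS: "subring (polyS m n)"
  unfolding subring_def
  by (auto intro: polyS_add polyS_uminus polyS_mult) (auto simp: polyS_iff_keys)

lemma polyS_Var: "v \<in> {1..m} \<times> {1..n} \<Longrightarrow> Var v \<in> polyS m n"
  unfolding Var_def by (intro polyS_single) auto

lemma polyS_diff: "f \<in> polyS m n \<Longrightarrow> g \<in> polyS m n \<Longrightarrow> f - g \<in> polyS m n"
  using polyS_add[of f m n "- g"] polyS_uminus[of g m n] by simp

lemma polyS_prod: "(\<And>x. x \<in> X \<Longrightarrow> f x \<in> polyS m n) \<Longrightarrow> prod f X \<in> polyS m n"
  using subring_polyS[of m n] unfolding subring_def
  by (induction X rule: infinite_finite_induct) auto

lemma polyS_minor:
  assumes "i \<in> {1..m}" "j \<in> {1..m}" "k \<in> {1..n}" "l \<in> {1..n}"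
  shows "minor k l i j \<in> polyS m n"
  unfolding minor_def using assms by (intro polyS_diff polyS_mult polyS_Var) auto

lemma is_ideal_J: "is_ideal (polyS m n) (J_KmPn m n :: (nat \<times> nat, 'a::field) mpoly set)"
  unfolding J_KmPn_def
proof (rule is_ideal_ideal_gen[OF subring_polyS], rule subsetI)
  fix x :: "(nat \<times> nat, 'a::field) mpoly"
  assume "x \<in> {Var (i, k) * Var (j, k + 1) - Var (i, k + 1) * Var (j, k) |i j k.
     1 \<le> i \<and> i < j \<and> j \<le> m \<and> 1 \<le> k \<and> k \<le> n - 1}"
  then obtain i j k where "x = minor k (Suc k) i j" "1 \<le> i" "i < j" "j \<le> m" "1 \<le> k" "k \<le> n - 1"
    by (auto simp: minor_def)
  then show "x \<in> polyS m n" by (auto intro!: polyS_minor)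
qed

lemma J_least:
  fixes I :: "(nat \<times> nat, 'a::field) mpoly set"
  assumes "is_ideal (polyS m n) I"
    and "\<And>i j k. 1 \<le> i \<Longrightarrow> i < j \<Longrightarrow> j \<le> m \<Longrightarrow> 1 \<le> k \<Longrightarrow> k < n \<Longrightarrow> minor k (Suc k) i j \<in> I"
  shows "J_KmPn m n \<subseteq> I"
  unfolding J_KmPn_def
proof (rule ideal_gen_least[OF assms(1)], rule subsetI)
  fix x :: "(nat \<times> nat, 'a::field) mpoly"
  assume "x \<in> {Var (i, k) * Var (j, k + 1) - Var (i, k + 1) * Var (j, k) |i j k.
     1 \<le> i \<and> i < j \<and> j \<le> m \<and> 1 \<le> k \<and> k \<le> n - 1}"
  then obtain i j k where "x = minor k (Suc k) i j" "1 \<le> i" "i < j" "j \<le> m" "1 \<le> k" "k \<le> n - 1"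
    by (auto simp: minor_def)
  then show "x \<in> I" by (auto intro!: assms(2))
qed

lemma adjacent_minor_in_J:
  assumes "i \<in> {1..m}" "j \<in> {1..m}" "1 \<le> k" "k < n"
  shows "minor k (Suc k) i j \<in> (J_KmPn m n :: (nat \<times> nat, 'a::field) mpoly set)"
proof -
  have *: "minor k (Suc k) i j \<in> (J_KmPn m n :: (nat \<times> nat, 'a::field) mpoly set)"
    if "1 \<le> i" "i < j" "j \<le> m" for i j
    unfolding J_KmPn_def
  proof (rule subsetD[OF ideal_gen_superset], rule CollectI, intro exI conjI)
    show "minor k (Suc k) i j = Var (i, k) * Var (j, k + 1) - Var (i, k + 1) * Var (j, k)"
      by (simp add: minor_def)
  qed (use that assms in auto)
  consider "i < j" | "i = j" | "j < i" by linarith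
  then show ?thesis
  proof cases
    case 1
    then show ?thesis using * assms by simp
  next
    case 2
    then show ?thesis using ideal_zero[OF is_ideal_J] by (simp add: minor_def mult.commute)
  next
    case 3
    then have "- minor k (Suc k) j i \<in> (J_KmPn m n :: (nat \<times> nat, 'a::field) mpoly set)"
      using * assms by (intro ideal_uminus[OF is_ideal_J]) simp
    then show ?thesis by (simp add: minor_def mult.commute)
  qed
qed

text \<open>Trades a minor of the columns \<open>k\<close>, \<open>q\<close> for minors of the pairs
  \<open>k\<close>, \<open>l\<close> and \<open>l\<close>, \<open>q\<close>, at the price of a
  factor from column \<open>l\<close>: the bridge from adjacent to distant columns.\<close>

lemma Var_mult_minor:
  "Var (r, l) * minor k q i j
     = Var (j, q) * minor k l i r + Var (r, k) * minor l q i j + Var (i, q) * minor k l r j"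
  by (simp add: minor_def algebra_simps)

text \<open>Bridge the intermediate columns one at a time by \<open>Var_mult_minor\<close> with
  \<open>r = 1\<close>. Taking all factors from row 1 makes the product independent of
  \<open>i\<close> and \<open>j\<close>.\<close>

lemma minor_times_between_in_J:
  assumes "1 \<le> k" "k < l" "l \<le> n" "i \<in> {1..m}" "j \<in> {1..m}"
  shows "(\<Prod>p\<in>{k<..<l}. Var (1, p)) * minor k l i j \<in> (J_KmPn m n :: (nat \<times> nat, 'a::field) mpoly set)"
  using assms(2-)
proof (induction l arbitrary: i j)
  case (Suc l)
  note m = is_ideal_J[of m n, where 'a='a]
  show ?case
  proof (cases "k = l")
    case True
    then have "{k<..<Suc l} = {}" by auto
    with True show ?thesis using Suc assms by (simp add: adjacent_minor_in_J)
  next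
    case False
    then have l: "k < l" "l \<le> n" using Suc by auto
    let ?p = "\<Prod>p\<in>{k<..<l}. Var (1, p) :: (nat \<times> nat, 'a) mpoly"
    have p: "?p \<in> polyS m n"
      using Suc assms by (intro polyS_prod polyS_Var) auto
    have "{k<..<Suc l} = insert l {k<..<l}" using l by auto
    then have "(\<Prod>p\<in>{k<..<Suc l}. Var (1, p)) * minor k (Suc l) i j = ?p * (Var (1, l) * minor k (Suc l) i j)"
      by (simp add: mult_ac)
    also have "\<dots> = Var (j, Suc l) * (?p * minor k l i 1) + ?p * (Var (1, k) * minor l (Suc l) i j)
        + Var (i, Suc l) * (?p * minor k l 1 j)"
      by (subst Var_mult_minor) (simp only: distrib_left mult_ac)
    also have "\<dots> \<in> J_KmPn m n"
      using Suc.prems assms(1) l p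
      by (intro ideal_add[OF m] ideal_mult[OF m] Suc.IH polyS_Var adjacent_minor_in_J) auto
    finally show ?thesis .
  qed
qed simp

text \<open>Bridging over column \<open>k\<close> leaves only adjacent minors.\<close>

lemma Var_times_straddling_minor_in_J:
  assumes "1 < k" "k < n" "r \<in> {1..m}" "i \<in> {1..m}" "j \<in> {1..m}"
  shows "Var (r, k) * minor (k - 1) (Suc k) i j \<in> (J_KmPn m n :: (nat \<times> nat, 'a::field) mpoly set)"
  using adjacent_minor_in_J[of _ m _ "k - 1" n, where 'a='a] assms
  by (subst Var_mult_minor)
    (intro ideal_add[OF is_ideal_J] ideal_mult[OF is_ideal_J] polyS_Var adjacent_minor_in_J; auto)

section \<open>Associated primes\<close>

text \<open>Variables of the parametrisation \<open>x\<^sub>r\<^sub>k = \<alpha>\<^sub>r\<^sub>b \<beta>\<^sub>k\<close> (\<open>b\<close> the block of column \<open>k\<close>) and of its deformation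
  \<open>x\<^sub>r\<^sub>k = \<alpha>\<^sub>r\<^sub>b \<beta>\<^sub>k + \<epsilon> y\<^sub>r\<^sub>k\<close>, tagged by the first component.\<close>

type_synonym pvar = "nat \<times> nat \<times> nat"

definition var_alpha :: "nat \<Rightarrow> nat \<Rightarrow> pvar" where "var_alpha r b = (0, r, b)"
definition var_beta :: "nat \<Rightarrow> pvar" where "var_beta k = (1, k, 0)"
definition var_y :: "nat \<times> nat \<Rightarrow> pvar" where "var_y v = (2, v)"
definition var_eps :: pvar where "var_eps = (3, 0, 0)"

lemmas pvar_defs = var_alpha_def var_beta_def var_y_def var_eps_def

text \<open>A cut column carries the index of the block to its right, but \<open>segre\<close> sends
  its variables to 0.\<close>

definition block :: "nat set \<Rightarrow> nat \<Rightarrow> nat" where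
  "block T k = card {j \<in> T. j \<le> k}"

definition segre_mono :: "nat set \<Rightarrow> nat \<times> nat \<Rightarrow> pvar \<Rightarrow>\<^sub>0 nat" where
  "segre_mono T v = Poly_Mapping.single (var_alpha (fst v) (block T (snd v))) 1
     + Poly_Mapping.single (var_beta (snd v)) 1"

definition segre :: "nat set \<Rightarrow> nat \<times> nat \<Rightarrow> (pvar, 'a::comm_ring_1) mpoly" where
  "segre T v = (if snd v \<in> T then 0 else Poly_Mapping.single (segre_mono T v) 1)"

lemma cuts_bounds: "cuts n T \<Longrightarrow> k \<in> T \<Longrightarrow> 2 \<le> k \<and> k < n"
  unfolding cuts_def by fastforce

lemma finite_cuts: "cuts n T \<Longrightarrow> finite T"
  unfolding cuts_def using finite_subset by blast

lemma block_eq_iff: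
  assumes "finite T" "k \<le> l"
  shows "block T k = block T l \<longleftrightarrow> T \<inter> {k<..l} = {}"
proof
  assume "block T k = block T l"
  then have "{j \<in> T. j \<le> k} = {j \<in> T. j \<le> l}"
    unfolding block_def using assms by (intro card_subset_eq) auto
  then show "T \<inter> {k<..l} = {}" by force
next
  assume *: "T \<inter> {k<..l} = {}"
  have "{j \<in> T. j \<le> k} = {j \<in> T. j \<le> l}"
  proof (intro Collect_cong conj_cong refl iffI)
    fix j assume "j \<in> T" "j \<le> l"
    with * show "j \<le> k" by (meson disjoint_iff greaterThanAtMost_iff not_le)
  qed (use assms in auto)
  then show "block T k = block T l" by (simp add: block_def)
qed

text \<open>Inside a block the image is a matrix of rank one; next to a cut both products contain a
  variable sent to 0.\<close>

lemma segre_adjacent_minor: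
  assumes "finite T"
  shows "peval (segre T) (minor k (Suc k) i j) = (0 :: (pvar, 'a::comm_ring_1) mpoly)"
proof (cases "k \<in> T \<or> Suc k \<in> T")
  case False
  then have "block T k = block T (Suc k)"
    using block_eq_iff[OF assms, of k "Suc k"] by (auto simp: le_Suc_eq)
  then show ?thesis using False
    by (simp add: minor_def peval_diff peval_mult segre_def segre_mono_def mult_single add_ac)
qed (auto simp: minor_def peval_diff peval_mult segre_def)

section \<open>The kernel of the parametrisation as a colon ideal\<close>

definition segre_prime :: "nat \<Rightarrow> nat \<Rightarrow> nat set \<Rightarrow> (nat \<times> nat, 'a::field) mpoly set" where
  "segre_prime m n T = {f \<in> polyS m n. peval (segre T) f = 0}"

text \<open>This is the kernel of a homomorphism into a domain, and 1 maps to 1.\<close>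

lemma prime_ideal_segre_prime: "prime_ideal (polyS m n) (segre_prime m n T :: (nat \<times> nat, 'a::field) mpoly set)"
proof -
  have "(1 :: (nat \<times> nat, 'a) mpoly) \<in> polyS m n" "1 \<notin> (segre_prime m n T :: (nat \<times> nat, 'a::field) mpoly set)"
    using subring_polyS[of m n, where 'a='a] by (auto simp: subring_def segre_prime_def)
  then have "segre_prime m n T \<noteq> (polyS m n :: (nat \<times> nat, 'a::field) mpoly set)"
    by metis
  then show ?thesis
    using subring_polyS[of m n, where 'a='a] unfolding prime_ideal_def
    by (auto simp: is_ideal_def subring_def segre_prime_def peval_add peval_uminus peval_mult)
qed

lemma J_subset_segre_prime:
  assumes "finite T"
  shows "J_KmPn m n \<subseteq> (segre_prime m n T :: (nat \<times> nat, 'a::field) mpoly set)"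
proof (rule J_least)
  show "is_ideal (polyS m n) (segre_prime m n T :: (nat \<times> nat, 'a::field) mpoly set)"
    using prime_ideal_segre_prime by (auto simp: prime_ideal_def)
qed (auto simp: segre_prime_def segre_adjacent_minor[OF assms] intro!: polyS_minor)

text \<open>Chosen such that the colon ideal of \<open>J_KmPn m n\<close> by it is
  \<open>segre_prime m n T\<close>: the row 1 variables bridge the columns of a block, and the minor
  straddling a cut column multiplies the variables of that column into the ideal.\<close>

definition cut_witness :: "nat \<Rightarrow> nat set \<Rightarrow> (nat \<times> nat, 'a::comm_ring_1) mpoly" where
  "cut_witness n T = (\<Prod>k\<in>{1..n} - T. Var (1, k)) * (\<Prod>k\<in>T. minor (k - 1) (Suc k) 1 2)"

lemma polyS_cut_witness:
  assumes "cuts n T" "m \<ge> 2"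
  shows "cut_witness n T \<in> polyS m n"
  unfolding cut_witness_def using assms(2)
  by (intro polyS_mult polyS_prod polyS_Var polyS_minor) (auto dest!: cuts_bounds[OF assms(1)])

text \<open>The target is a domain, so factors can be treated singly. The columns
  \<open>k - 1\<close> and \<open>k + 1\<close> around a cut lie in different blocks, hence the
  straddling minor maps to a difference of two distinct monomials.\<close>

lemma cut_witness_not_in_segre_prime:
  assumes "cuts n T"
  shows "peval (segre T) (cut_witness n T) \<noteq> (0 :: (pvar, 'a::field) mpoly)"
proof -
  note fin = finite_cuts[OF assms]
  have "peval (segre T) (Var (1, k)) \<noteq> (0 :: (pvar, 'a) mpoly)" if "k \<in> {1..n} - T" for k
    using that by (simp add: segre_def) (metis lookup_single_eq lookup_zero zero_neq_one)
  moreover have "peval (segre T) (minor (k - 1) (Suc k) 1 2) \<noteq> (0 :: (pvar, 'a) mpoly)" if "k \<in> T" for k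
  proof -
    have "2 \<le> k" and no: "\<And>j. j \<in> T \<Longrightarrow> Suc j \<notin> T"
      using assms that by (auto simp: cuts_def)
    then have k: "k \<ge> 2" "Suc k \<notin> T" "k - 1 \<notin> T"
      using that no[of "k - 1"] by auto
    have b: "block T (k - 1) \<noteq> block T (Suc k)"
      using that k block_eq_iff[OF fin, of "k - 1" "Suc k"] by auto
    let ?u = "segre_mono T (1, k - 1) + segre_mono T (2, Suc k)"
    let ?v = "segre_mono T (1, Suc k) + segre_mono T (2, k - 1)"
    have "Poly_Mapping.lookup ?u (var_alpha 1 (block T (k - 1))) = 1"
         "Poly_Mapping.lookup ?v (var_alpha 1 (block T (k - 1))) = 0"
      using b by (simp_all add: segre_mono_def lookup_add lookup_single pvar_defs)
    then have "?u \<noteq> ?v" by auto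
    moreover have "peval (segre T) (minor (k - 1) (Suc k) 1 2)
        = Poly_Mapping.single ?u 1 - (Poly_Mapping.single ?v 1 :: (pvar, 'a) mpoly)"
      using k by (simp add: minor_def peval_diff peval_mult segre_def mult_single)
    ultimately show ?thesis
      by (metis (no_types) eq_iff_diff_eq_0 lookup_single_eq lookup_single_not_eq zero_neq_one)
  qed
  ultimately show ?thesis
    using fin by (simp add: cut_witness_def peval_mult peval_prod)
qed

lemma Var_times_cut_witness_in_J:
  assumes "cuts n T" "m \<ge> 2" "k \<in> T" "r \<in> {1..m}"
  shows "Var (r, k) * cut_witness n T \<in> (J_KmPn m n :: (nat \<times> nat, 'a::field) mpoly set)"
proof -
  let ?M = "\<lambda>k. minor (k - 1) (Suc k) 1 2 :: (nat \<times> nat, 'a) mpoly"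
  note T = cuts_bounds[OF assms(1)]
  have "(\<Prod>k\<in>T. ?M k) = ?M k * (\<Prod>k\<in>T - {k}. ?M k)"
    using assms by (intro prod.remove finite_cuts)
  then have "Var (r, k) * cut_witness n T
      = ((\<Prod>k\<in>{1..n} - T. Var (1, k)) * (\<Prod>k\<in>T - {k}. ?M k)) * (Var (r, k) * ?M k)"
    by (simp add: cut_witness_def mult_ac)
  also have "\<dots> \<in> J_KmPn m n"
  proof (rule ideal_mult[OF is_ideal_J])
    show "(\<Prod>k\<in>{1..n} - T. Var (1, k)) * (\<Prod>k\<in>T - {k}. ?M k) \<in> polyS m n"
      using assms by (intro polyS_mult polyS_prod polyS_Var polyS_minor) (auto dest!: T)
    show "Var (r, k) * ?M k \<in> J_KmPn m n"
      using T[OF assms(3)] assms by (intro Var_times_straddling_minor_in_J) auto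
  qed
  finally show ?thesis .
qed

lemma block_minor_times_cut_witness_in_J:
  assumes T: "cuts n T" and m: "m \<ge> 2" and "k \<notin> T" "l \<notin> T" "block T k = block T l"
    and "k \<in> {1..n}" "l \<in> {1..n}" "i \<in> {1..m}" "j \<in> {1..m}"
  shows "minor k l i j * cut_witness n T \<in> (J_KmPn m n :: (nat \<times> nat, 'a::field) mpoly set)"
  using assms(3-)
proof (induction k l rule: linorder_wlog)
  case (le k l)
  note J = is_ideal_J[of m n, where 'a='a]
  show ?case
  proof (cases "k = l")
    case True
    then show ?thesis using ideal_zero[OF J] by (simp add: minor_def)
  next
    case False
    then have kl: "k < l" using le by simp
    have "T \<inter> {k<..l} = {}"
      using le block_eq_iff[OF finite_cuts[OF T]] by simp
    \<comment> \<open>No cut separates the two columns, so all bridging variables are factors of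
      \<open>cut_witness\<close>.\<close>
    then have sub: "{k<..<l} \<subseteq> {1..n} - T" using le by auto
    let ?R = "(\<Prod>k\<in>({1..n} - T) - {k<..<l}. Var (1, k)) * (\<Prod>k\<in>T. minor (k - 1) (Suc k) 1 2) :: (nat \<times> nat, 'a) mpoly"
    have "(\<Prod>k\<in>{1..n} - T. Var (1, k) :: (nat \<times> nat, 'a) mpoly) = (\<Prod>k\<in>({1..n} - T) - {k<..<l}. Var (1, k)) * (\<Prod>k\<in>{k<..<l}. Var (1, k))"
      using sub by (intro prod.subset_diff) auto
    then have "minor k l i j * cut_witness n T = ?R * ((\<Prod>k\<in>{k<..<l}. Var (1, k)) * minor k l i j)"
      by (simp only: cut_witness_def mult_ac)
    also have "\<dots> \<in> J_KmPn m n"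
    proof (rule ideal_mult[OF J])
      show "?R \<in> polyS m n"
        using m by (intro polyS_mult polyS_prod polyS_Var polyS_minor) (auto dest!: cuts_bounds[OF T])
      show "(\<Prod>k\<in>{k<..<l}. Var (1, k)) * minor k l i j \<in> J_KmPn m n"
        using le kl by (intro minor_times_between_in_J) auto
    qed
    finally show ?thesis .
  qed
next
  case (sym k l)
  then have "- (minor l k i j * cut_witness n T) \<in> (J_KmPn m n :: (nat \<times> nat, 'a::field) mpoly set)"
    by (intro ideal_uminus[OF is_ideal_J]) simp
  then show ?case by (simp add: minor_def algebra_simps)
qed

text \<open>Two monomials with the same image under the parametrisation are connected by swaps
  \<open>x\<^sub>j\<^sub>k x\<^sub>i\<^sub>l \<leadsto> x\<^sub>i\<^sub>k x\<^sub>j\<^sub>l\<close> inside a block.\<close>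

lemma segre_fibre_connected:
  fixes Q :: "(nat \<times> nat, 'a::field) mpoly set"
  assumes Q: "is_ideal (polyS m n) Q"
    and swap: "\<And>i j k l. i \<in> {1..m} \<Longrightarrow> j \<in> {1..m} \<Longrightarrow> k \<in> {1..n} - T \<Longrightarrow> l \<in> {1..n} - T \<Longrightarrow>
      block T k = block T l \<Longrightarrow> minor k l i j \<in> Q"
    and "Poly_Mapping.keys u \<subseteq> {1..m} \<times> ({1..n} - T)" "Poly_Mapping.keys u' \<subseteq> {1..m} \<times> ({1..n} - T)"
    and "mext (segre_mono T) u = mext (segre_mono T) u'"
  shows "Poly_Mapping.single u 1 - Poly_Mapping.single u' 1 \<in> Q"
  using assms(3-)
proof (induction u' arbitrary: u rule: monomial_induct)
  case zero
  have "u = 0"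
  proof (rule ccontr)
    assume "u \<noteq> 0"
    then obtain v where "v \<in> Poly_Mapping.keys u"
      by (metis ex_in_conv keys_eq_empty)
    then obtain u0 where "u = u0 + Poly_Mapping.single v 1"
      by (rule monomial_decompose)
    then have "mext (segre_mono T) u0 + segre_mono T v = 0"
      using zero by (simp add: mext_add)
    then have "Poly_Mapping.lookup (mext (segre_mono T) u0 + segre_mono T v) (var_beta (snd v)) = 0"
      by simp
    then show False by (simp add: lookup_add segre_mono_def)
  qed
  then show ?case using ideal_zero[OF Q] by simp
next
  case (add u' v)
  obtain i k where v: "v = (i, k)" by (cases v)
  have ik: "i \<in> {1..m}" "k \<in> {1..n} - T"
    using add.prems(2) v by (auto simp: keys_add_nat)
  let ?X = "{1..m} \<times> ({1..n} - T)"
  \<comment> \<open>At most one swap makes \<open>v\<close> a factor of \<open>u\<close>; the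
    induction hypothesis then applies to the cofactors.\<close>
  obtain u0 where u0: "Poly_Mapping.keys u0 \<subseteq> ?X"
      "mext (segre_mono T) u = mext (segre_mono T) (u0 + Poly_Mapping.single v 1)"
      "Poly_Mapping.single u 1 - Poly_Mapping.single (u0 + Poly_Mapping.single v 1) 1 \<in> Q"
  proof (cases "v \<in> Poly_Mapping.keys u")
    case True
    then obtain u0 where "u = u0 + Poly_Mapping.single v 1"
      by (rule monomial_decompose)
    then show ?thesis
      using add.prems(1) ideal_zero[OF Q] by (intro that[of u0]) (auto simp: keys_add_nat)
  next
    case False
    \<comment> \<open>The degree in \<open>\<beta>\<^sub>k\<close> yields a factor \<open>w\<close>
      of \<open>u\<close> in column \<open>k\<close>, and the degree in the \<open>\<alpha>\<close>
      of row \<open>i\<close> a factor \<open>z\<close> in row \<open>i\<close> of the same block.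
      Exchanging their columns creates \<open>v\<close>.\<close>
    have "Poly_Mapping.lookup (mext (segre_mono T) u) (var_beta k) > 0"
      unfolding add.prems(3) v by (simp add: mext_add lookup_add segre_mono_def)
    then obtain w where w: "w \<in> Poly_Mapping.keys u" "Poly_Mapping.lookup (segre_mono T w) (var_beta k) > 0"
      unfolding lookup_mext by (rule mext_nat_pos)
    obtain j where wj: "w = (j, k)"
      using w(2) by (cases w) (auto simp: segre_mono_def lookup_add lookup_single pvar_defs when_def split: if_splits)
    have "Poly_Mapping.lookup (mext (segre_mono T) u) (var_alpha i (block T k)) > 0"
      unfolding add.prems(3) v by (simp add: mext_add lookup_add segre_mono_def)
    then obtain z where z: "z \<in> Poly_Mapping.keys u"
        "Poly_Mapping.lookup (segre_mono T z) (var_alpha i (block T k)) > 0"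
      unfolding lookup_mext by (rule mext_nat_pos)
    obtain l where zl: "z = (i, l)" "block T l = block T k"
      using z(2) by (cases z) (auto simp: segre_mono_def lookup_add lookup_single pvar_defs when_def split: if_splits)
    have jl: "j \<in> {1..m}" "l \<in> {1..n} - T"
      using w(1) z(1) wj zl add.prems(1) by auto
    obtain u1 where u1: "u = u1 + Poly_Mapping.single w 1"
      using w(1) by (rule monomial_decompose)
    have "z \<noteq> w" using False z(1) wj zl v by auto
    then have "z \<in> Poly_Mapping.keys u1"
      using z(1) by (auto simp: u1 keys_add_nat)
    then obtain u2 where u2: "u1 = u2 + Poly_Mapping.single z 1"
      by (rule monomial_decompose)
    show ?thesis
    proof (rule that[of "u2 + Poly_Mapping.single (j, l) 1"])
      show "Poly_Mapping.keys (u2 + Poly_Mapping.single (j, l) 1) \<subseteq> ?X"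
        using add.prems(1) jl by (auto simp: keys_add_nat u1 u2)
      show "mext (segre_mono T) u = mext (segre_mono T) (u2 + Poly_Mapping.single (j, l) 1 + Poly_Mapping.single v 1)"
        by (simp add: u1 u2 mext_add wj zl v segre_mono_def add_ac)
      have "Poly_Mapping.single u2 1 * minor k l j i \<in> Q"
      proof (rule ideal_mult[OF Q])
        show "Poly_Mapping.single u2 1 \<in> polyS m n"
          using add.prems(1) by (intro polyS_single) (auto simp: u1 u2 keys_add_nat)
      qed (use swap ik jl zl in auto)
      moreover have "Poly_Mapping.single u2 1 * minor k l j i = Poly_Mapping.single u 1
          - Poly_Mapping.single (u2 + Poly_Mapping.single (j, l) 1 + Poly_Mapping.single v 1) (1 :: 'a)"
        by (simp add: minor_def Var_def u1 u2 mult_single right_diff_distrib wj zl v add_ac)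
      ultimately show "Poly_Mapping.single u 1
          - Poly_Mapping.single (u2 + Poly_Mapping.single (j, l) 1 + Poly_Mapping.single v 1) 1 \<in> Q"
        by simp
    qed
  qed
  have "Poly_Mapping.single u0 1 - Poly_Mapping.single u' 1 \<in> Q"
    using u0 add.prems by (intro add.IH) (auto simp: keys_add_nat mext_add)
  then have "Var v * (Poly_Mapping.single u0 1 - Poly_Mapping.single u' 1) \<in> Q"
    using ik v by (intro ideal_mult[OF Q] polyS_Var) auto
  with u0(3) have "(Poly_Mapping.single u 1 - Poly_Mapping.single (u0 + Poly_Mapping.single v 1) 1)
      + Var v * (Poly_Mapping.single u0 1 - Poly_Mapping.single u' 1) \<in> Q"
    by (rule ideal_add[OF Q])
  then show ?case
    by (simp add: Var_def right_diff_distrib mult_single add_ac)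
qed

text \<open>Induction on the number of terms: a chosen monomial of \<open>h\<close> is cancelled by
  an element of \<open>Q\<close> with image 0 that brings in no new monomials. \<open>Q\<close> is
  left general so that it can be the colon ideal by \<open>cut_witness\<close>.\<close>

lemma segre_prime_least:
  fixes Q :: "(nat \<times> nat, 'a::field) mpoly set"
  assumes Q: "is_ideal (polyS m n) Q"
    and swap: "\<And>i j k l. i \<in> {1..m} \<Longrightarrow> j \<in> {1..m} \<Longrightarrow> k \<in> {1..n} - T \<Longrightarrow> l \<in> {1..n} - T \<Longrightarrow>
      block T k = block T l \<Longrightarrow> minor k l i j \<in> Q"
    and cut: "\<And>r k. r \<in> {1..m} \<Longrightarrow> k \<in> T \<inter> {1..n} \<Longrightarrow> Var (r, k) \<in> Q"
  shows "segre_prime m n T \<subseteq> Q"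
proof
  fix h :: "(nat \<times> nat, 'a) mpoly"
  assume "h \<in> segre_prime m n T"
  then show "h \<in> Q"
  proof (induction "card (Poly_Mapping.keys h)" arbitrary: h rule: less_induct)
    case less
    let ?X = "{1..m} \<times> ({1..n} - T)"
    have h: "h \<in> polyS m n" "peval (segre T) h = 0"
      using less.prems by (auto simp: segre_prime_def)
    show ?case
    proof (cases "h = 0")
      case True
      then show ?thesis using ideal_zero[OF Q] by simp
    next
      case False
      then obtain u where u: "u \<in> Poly_Mapping.keys h"
        by (metis ex_in_conv keys_eq_empty)
      have uS: "Poly_Mapping.keys u \<subseteq> {1..m} \<times> {1..n}"
        using h u by (auto simp: polyS_iff_keys)
      let ?c = "Poly_Mapping.lookup h u"
      obtain g where g: "g \<in> Q" "peval (segre T) g = 0" "Poly_Mapping.lookup g u = 1"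
        "Poly_Mapping.keys g \<subseteq> Poly_Mapping.keys h"
      proof (cases "Poly_Mapping.keys u \<subseteq> ?X")
        case False
        then obtain r k where rk: "(r, k) \<in> Poly_Mapping.keys u" "k \<in> T" "r \<in> {1..m}" "k \<in> {1..n}"
          using uS by fastforce
        obtain u' where u': "u = u' + Poly_Mapping.single (r, k) 1"
          using rk(1) by (rule monomial_decompose)
        have eq: "Poly_Mapping.single u (1::'a) = Poly_Mapping.single u' 1 * Var (r, k)"
          by (simp add: Var_def mult_single u')
        show ?thesis
        proof (rule that[of "Poly_Mapping.single u 1"])
          show "Poly_Mapping.single u 1 \<in> Q"
            unfolding eq using uS rk
            by (intro ideal_mult[OF Q] polyS_single cut) (auto simp: u' keys_add_nat)
          show "peval (segre T) (Poly_Mapping.single u (1::'a)) = 0"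
            unfolding eq peval_mult using rk by (simp add: segre_def)
        qed (use u in auto)
      next
        case True
        have eval: "peval (segre T) (Poly_Mapping.single \<mu> c) = Poly_Mapping.single (mext (segre_mono T) \<mu>) c"
          if "Poly_Mapping.keys \<mu> \<subseteq> ?X" for \<mu> and c :: 'a
        proof -
          have "meval (segre T) \<mu> = Poly_Mapping.single (mext (segre_mono T) \<mu>) (1::'a)"
            using that by (intro meval_monomials) (auto simp: segre_def)
          then show ?thesis by (simp add: peval_single mult_single)
        qed
        \<comment> \<open>The image of \<open>h\<close> is 0, so the contribution of
          \<open>u\<close> must cancel against another monomial of \<open>h\<close> with the same
          image.\<close>
        have "\<exists>u'\<in>Poly_Mapping.keys h. u' \<noteq> u \<and> Poly_Mapping.keys u' \<subseteq> ?X
            \<and> mext (segre_mono T) u' = mext (segre_mono T) u"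
        proof (rule ccontr)
          assume contra: "\<not> ?thesis"
          have zero: "Poly_Mapping.lookup (peval (segre T) (Poly_Mapping.single \<mu> (Poly_Mapping.lookup h \<mu>)))
              (mext (segre_mono T) u) = 0" if \<mu>: "\<mu> \<in> Poly_Mapping.keys h - {u}" for \<mu>
          proof (cases "Poly_Mapping.keys \<mu> \<subseteq> ?X")
            case True
            then show ?thesis using contra \<mu> by (auto simp: eval lookup_single when_def)
          next
            case False
            have "Poly_Mapping.keys \<mu> \<subseteq> {1..m} \<times> {1..n}"
              using h \<mu> by (auto simp: polyS_iff_keys)
            then obtain r k where rk: "(r, k) \<in> Poly_Mapping.keys \<mu>" "k \<in> T"
              using False by fastforce
            obtain \<mu>' where "\<mu> = \<mu>' + Poly_Mapping.single (r, k) 1"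
              using rk(1) by (rule monomial_decompose)
            then have "meval (segre T) \<mu> = (0 :: (pvar, 'a) mpoly)"
              using \<open>k \<in> T\<close> by (simp add: meval_add segre_def)
            then show ?thesis by (simp add: peval_single)
          qed
          have "0 = Poly_Mapping.lookup (peval (segre T) h) (mext (segre_mono T) u)"
            by (simp add: h)
          also have "\<dots> = (\<Sum>\<mu>\<in>Poly_Mapping.keys h. Poly_Mapping.lookup
              (peval (segre T) (Poly_Mapping.single \<mu> (Poly_Mapping.lookup h \<mu>))) (mext (segre_mono T) u))"
            by (simp add: peval_def[of _ h] peval_single lookup_sum)
          also have "\<dots> = Poly_Mapping.lookup
              (peval (segre T) (Poly_Mapping.single u ?c)) (mext (segre_mono T) u)"
            using u zero by (subst sum.remove[of _ u]) auto
          also have "\<dots> = ?c" by (simp add: eval[OF True])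
          finally show False using u by (simp add: in_keys_iff)
        qed
        then obtain u' where u': "u' \<in> Poly_Mapping.keys h" "u' \<noteq> u" "Poly_Mapping.keys u' \<subseteq> ?X"
            "mext (segre_mono T) u' = mext (segre_mono T) u"
          by blast
        show ?thesis
        proof (rule that[of "Poly_Mapping.single u 1 - Poly_Mapping.single u' 1"])
          show "Poly_Mapping.single u 1 - Poly_Mapping.single u' 1 \<in> Q"
            using True u' by (intro segre_fibre_connected[OF Q, of T] swap) auto
          show "Poly_Mapping.keys (Poly_Mapping.single u 1 - Poly_Mapping.single u' (1::'a)) \<subseteq> Poly_Mapping.keys h"
            using u u' keys_diff_pm[of "Poly_Mapping.single u (1::'a)" "Poly_Mapping.single u' 1"] by auto
        qed (use u' in \<open>simp_all add: peval_diff eval[OF True] eval[OF u'(3)] lookup_minus lookup_single\<close>)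
      qed
      define h' where "h' = h - Poly_Mapping.single 0 ?c * g"
      have lookup': "Poly_Mapping.lookup h' x = Poly_Mapping.lookup h x - ?c * Poly_Mapping.lookup g x" for x
        by (simp add: h'_def lookup_minus Poly_Mapping.map.rep_eq when_def flip: mult_map_scale_conv_mult)
      have cg: "Poly_Mapping.single 0 ?c * g \<in> Q"
        using g by (intro ideal_mult[OF Q] polyS_single) auto
      have "Poly_Mapping.keys h' \<subseteq> Poly_Mapping.keys h - {u}"
        using g(3) subsetD[OF g(4)] by (auto simp: in_keys_iff lookup')
      then have "card (Poly_Mapping.keys h') < card (Poly_Mapping.keys h)"
        using u by (metis card_Diff1_less card_mono finite_Diff finite_keys le_less_trans)
      moreover have "h' \<in> segre_prime m n T"
        using h g ideal_subset[OF Q cg] by (auto simp: segre_prime_def h'_def peval_diff peval_mult intro: polyS_diff)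
      ultimately have "h' \<in> Q" by (rule less.hyps)
      then have "h' + Poly_Mapping.single 0 ?c * g \<in> Q" using cg by (rule ideal_add[OF Q])
      then show ?thesis by (simp add: h'_def)
    qed
  qed
qed

text \<open>The prime contains \<open>J_KmPn m n\<close> but not \<open>cut_witness n T\<close>, so
  it contains the colon ideal; the converse inclusion is \<open>segre_prime_least\<close> for that
  colon ideal.\<close>

lemma segre_prime_in_Ass:
  assumes T: "cuts n T" and m: "m \<ge> 2"
  shows "segre_prime m n T \<in> Ass (polyS m n) (J_KmPn m n :: (nat \<times> nat, 'a::field) mpoly set)"
proof -
  let ?J = "J_KmPn m n :: (nat \<times> nat, 'a) mpoly set"
  let ?g = "cut_witness n T :: (nat \<times> nat, 'a) mpoly"
  let ?Q = "{h \<in> polyS m n. h * ?g \<in> ?J}"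
  have g: "?g \<in> polyS m n" by (rule polyS_cut_witness[OF T m])
  have "?Q \<subseteq> segre_prime m n T"
    using J_subset_segre_prime[OF finite_cuts[OF T], of m n, where 'a='a]
      cut_witness_not_in_segre_prime[OF T, where 'a='a]
    by (auto simp: segre_prime_def peval_mult)
  moreover have "segre_prime m n T \<subseteq> ?Q"
  proof (rule segre_prime_least)
    show "is_ideal (polyS m n) ?Q"
      by (rule is_ideal_colon[OF subring_polyS is_ideal_J g])
  qed (use block_minor_times_cut_witness_in_J[OF T m, where 'a='a] Var_times_cut_witness_in_J[OF T m, where 'a='a]
      in \<open>auto intro: polyS_minor polyS_Var\<close>)
  ultimately show ?thesis
    using prime_ideal_segre_prime g unfolding Ass_def by blast
qed

section \<open>Deforming the parametrisation along a lattice path\<close>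

definition path_sum :: "(nat \<Rightarrow> nat) \<Rightarrow> nat \<Rightarrow> int" where
  "path_sum c k = (\<Sum>j<k. int (c j))"

lemma steps_antitone:
  assumes "steps m n T c" "k \<le> l" "l \<le> n" "T \<inter> {k<..l} = {}"
  shows "c l \<le> c k"
  using assms(2-)
proof (induction l rule: dec_induct)
  case (step l)
  have "Suc l \<in> {1..n} - T"
    using step by auto
  then have "c (Suc l) \<le> c l"
    using assms(1) unfolding steps_def by (metis diff_Suc_1)
  also have "c l \<le> c k"
    using step by (intro step.IH) auto
  finally show ?case .
qed simp

text \<open>From column \<open>l\<close> to \<open>l + 1\<close> the value
  \<open>r * l - path_sum c l\<close> changes by \<open>r - c l\<close>. As \<open>c\<close> does
  not increase inside a block, the value is convex in \<open>l\<close> and minimal where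
  \<open>c k \<le> r \<le> c (k - 1)\<close>.\<close>

lemma lattice_path_minimises:
  assumes st: "steps m n T c" and fin: "finite T" and rk: "(r, k) \<in> lattice_path T c"
    and k: "k \<in> {1..n}" and l: "l \<in> {1..n}" "l \<notin> T" "block T l = block T k"
  shows "int r * int k - path_sum c k \<le> int r * int l - path_sum c l"
proof (cases "k \<le> l")
  case True
  have "T \<inter> {k<..l} = {}"
    using l block_eq_iff[OF fin True] by simp
  from True this l(1) show ?thesis
  proof (induction l rule: dec_induct)
    case (step l)
    have "c l \<le> c k"
      using step by (intro steps_antitone[OF st]) auto
    also have "c k \<le> r" using rk by (simp add: lattice_path_def)
    finally have "int (c l) \<le> int r" by simp
    moreover have "int r * int k - path_sum c k \<le> int r * int l - path_sum c l"
      using step k by (intro step.IH) auto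
    ultimately show ?case by (simp add: path_sum_def algebra_simps)
  qed simp
next
  case False
  then have "l \<le> k" by simp
  have "T \<inter> {l<..k} = {}"
    using l block_eq_iff[OF fin \<open>l \<le> k\<close>] by simp
  from \<open>l \<le> k\<close> this show ?thesis
  proof (induction l rule: inc_induct)
    case (step l)
    have "r \<le> c (k - 1)" using rk by (simp add: lattice_path_def)
    also have "c (k - 1) \<le> c l"
      using step k by (intro steps_antitone[OF st]) (auto simp: disjoint_iff)
    finally have "int r \<le> int (c l)" by simp
    moreover have "int r * int k - path_sum c k \<le> int r * int (Suc l) - path_sum c (Suc l)"
      using step by (intro step.IH) auto
    ultimately show ?case by (simp add: path_sum_def algebra_simps)
  qed simp
qed

definition grid_weight :: "nat \<times> nat \<Rightarrow> int" where
  "grid_weight v = int (fst v) * int (snd v)"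

text \<open>The weights of the \<open>\<alpha>\<close> and \<open>\<beta>\<close> are dual potentials for \<open>grid_weight\<close>: their sum is at most \<open>r k\<close>,
  with equality exactly on the lattice path.\<close>

definition alpha_weight :: "nat \<Rightarrow> nat set \<Rightarrow> (nat \<Rightarrow> nat) \<Rightarrow> nat \<Rightarrow> nat \<Rightarrow> int" where
  "alpha_weight n T c r b = Min ((\<lambda>l. int r * int l - path_sum c l) ` {l \<in> {1..n} - T. block T l = b})"

definition pvar_weight :: "nat \<Rightarrow> nat set \<Rightarrow> (nat \<Rightarrow> nat) \<Rightarrow> pvar \<Rightarrow> int" where
  "pvar_weight n T c = (\<lambda>(tag, a, b). if tag = 0 then alpha_weight n T c a b else if tag = 1 then path_sum c a
     else if tag = 2 then grid_weight (a, b) else 0)"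

lemma alpha_weight_le:
  assumes "l \<in> {1..n} - T"
  shows "alpha_weight n T c r (block T l) \<le> int r * int l - path_sum c l"
  unfolding alpha_weight_def using assms by (intro Min_le) auto

lemma alpha_weight_on_path:
  assumes "steps m n T c" "finite T" "(r, k) \<in> lattice_path T c" "k \<in> {1..n}"
  shows "alpha_weight n T c r (block T k) = int r * int k - path_sum c k"
  unfolding alpha_weight_def using assms lattice_path_minimises[OF assms]
  by (intro Min_eqI) (auto simp: lattice_path_def)

text \<open>One column closer to the path the value is smaller, by \<open>c k - r\<close> or by
  \<open>r - c (k - 1)\<close>. That column is still in the block: at the block ends
  \<open>c\<close> is 1 on the right and \<open>m\<close> on the left, which excludes
  \<open>r < c k\<close> and \<open>c (k - 1) < r\<close> respectively.\<close>

lemma alpha_weight_off_path: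
  assumes st: "steps m n T c" and fin: "finite T" and rk: "(r, k) \<notin> lattice_path T c" "k \<in> {1..n} - T" "r \<in> {1..m}"
  shows "alpha_weight n T c r (block T k) < int r * int k - path_sum c k"
proof -
  consider "r < c k" | "c (k - 1) < r"
    using rk by (force simp: lattice_path_def)
  then show ?thesis
  proof cases
    case 1
    have "Suc k \<notin> T" "k \<noteq> n"
      using 1 st rk by (force simp: steps_def)+
    then have "Suc k \<in> {1..n} - T" "block T k = block T (Suc k)"
      using rk block_eq_iff[OF fin, of k "Suc k"] by (auto simp: le_Suc_eq)
    then have "alpha_weight n T c r (block T k) \<le> int r * int (Suc k) - path_sum c (Suc k)"
      using alpha_weight_le[of "Suc k" n T c r] by simp
    then show ?thesis using 1 by (simp add: path_sum_def algebra_simps)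
  next
    case 2
    obtain l where l: "k = Suc l" using rk by (cases k) auto
    have "l \<notin> T"
      using 2 st rk l by (auto simp: steps_def)
    moreover have "l \<noteq> 0"
      using 2 st rk l by (cases l) (auto simp: steps_def)
    ultimately have "l \<in> {1..n} - T" "block T l = block T k"
      using rk l block_eq_iff[OF fin, of l k] by (auto simp: le_Suc_eq)
    then have "alpha_weight n T c r (block T k) \<le> int r * int l - path_sum c l"
      using alpha_weight_le[of l n T c r] by simp
    then show ?thesis using 2 l by (simp add: path_sum_def algebra_simps)
  qed
qed

section \<open>The deformed substitution and its leading monomials\<close>

definition deform :: "nat set \<Rightarrow> (nat \<Rightarrow> nat) \<Rightarrow> nat \<times> nat \<Rightarrow> (pvar, 'a::comm_ring_1) mpoly" where
  "deform T c v = (if v \<in> lattice_path T c then segre T v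
     else Poly_Mapping.single (Poly_Mapping.single var_eps 1 + Poly_Mapping.single (var_y v) 1) 1 + segre T v)"

text \<open>Both choices weigh \<open>r * k\<close> for the cell \<open>(r, k)\<close> of the grid;
  off the path \<open>\<epsilon> y\<close> is strictly heavier than the term from
  \<open>segre\<close>, which is 0 in cut columns.\<close>

definition deform_lead :: "nat set \<Rightarrow> (nat \<Rightarrow> nat) \<Rightarrow> nat \<times> nat \<Rightarrow> pvar \<Rightarrow>\<^sub>0 nat" where
  "deform_lead T c v = (if v \<in> lattice_path T c then segre_mono T v
     else Poly_Mapping.single var_eps 1 + Poly_Mapping.single (var_y v) 1)"

lemma pvar_weight_simps:
  "pvar_weight n T c (var_alpha r b) = alpha_weight n T c r b"
  "pvar_weight n T c (var_beta k) = path_sum c k"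
  "pvar_weight n T c (var_y v) = grid_weight v"
  "pvar_weight n T c var_eps = 0"
  by (simp_all add: pvar_weight_def pvar_defs split: prod.split)

lemma weight_deform_lead:
  assumes "steps m n T c" "finite T" "v \<in> {1..m} \<times> {1..n}"
  shows "mext (pvar_weight n T c) (deform_lead T c v) = grid_weight v"
  using assms alpha_weight_on_path[OF assms(1,2), of "fst v" "snd v"]
  by (auto simp: deform_lead_def segre_mono_def mext_add pvar_weight_simps grid_weight_def)

lemma led_by_deform:
  assumes st: "steps m n T c" and fin: "finite T" and v: "v \<in> {1..m} \<times> {1..n}"
  shows "led_by (pvar_weight n T c) (deform T c v :: (pvar, 'a::comm_ring_1) mpoly) (deform_lead T c v)"
proof (cases "v \<in> lattice_path T c")
  case True
  then have "deform T c v = (Poly_Mapping.single (deform_lead T c v) 1 :: (pvar, 'a) mpoly)"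
    by (auto simp: deform_def deform_lead_def segre_def lattice_path_def)
  then show ?thesis by (simp add: led_by_single)
next
  case False
  have "led_by (pvar_weight n T c) (Poly_Mapping.single (deform_lead T c v) 1 + (segre T v :: (pvar, 'a) mpoly)) (deform_lead T c v)"
  proof (rule led_by_single_add)
    fix \<kappa> assume "\<kappa> \<in> Poly_Mapping.keys (segre T v :: (pvar, 'a) mpoly)"
    then have "snd v \<notin> T" and \<kappa>: "\<kappa> = segre_mono T v"
      by (auto simp: segre_def split: if_splits)
    then have "alpha_weight n T c (fst v) (block T (snd v)) < grid_weight v - path_sum c (snd v)"
      unfolding grid_weight_def using v False by (intro alpha_weight_off_path[OF st fin]) auto
    then show "mext (pvar_weight n T c) \<kappa> < mext (pvar_weight n T c) (deform_lead T c v)"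
      unfolding weight_deform_lead[OF st fin v] \<kappa>
      by (simp add: segre_mono_def mext_add pvar_weight_simps)
  qed
  then show ?thesis using False by (simp add: deform_def deform_lead_def)
qed

lemma sum_nat_cancel_term:
  fixes f g :: "'b \<Rightarrow> nat"
  assumes "finite X" "x \<in> X" "sum f X = sum g X" "\<And>y. y \<in> X \<Longrightarrow> y \<noteq> x \<Longrightarrow> f y = g y"
  shows "f x = g x"
proof -
  have "sum f (X - {x}) = sum g (X - {x})"
    using assms by (intro sum.cong) auto
  then show ?thesis using assms(1-3) by (simp add: sum.remove)
qed

text \<open>Exponents off the path are read off from the \<open>y\<close>. On the path, go through
  the columns from left to right: a row \<open>q > c k\<close> of column \<open>k\<close> has no
  later path cell in the block, so the degree in its \<open>\<alpha>\<close> settles its exponent;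
  the cell in row \<open>c k\<close> is then settled by \<open>\<beta>\<^sub>k\<close>.\<close>

lemma deform_lead_inj:
  assumes st: "steps m n T c" and fin: "finite T"
    and u: "Poly_Mapping.keys u \<subseteq> {1..m} \<times> {1..n}" and u': "Poly_Mapping.keys u' \<subseteq> {1..m} \<times> {1..n}"
    and eq: "mext (deform_lead T c) u = mext (deform_lead T c) u'"
  shows "u = u'"
proof -
  let ?X = "{1..m} \<times> {1..n}" and ?P = "lattice_path T c"
  have sums: "(\<Sum>w\<in>?X. Poly_Mapping.lookup u w * Poly_Mapping.lookup (deform_lead T c w) x)
      = (\<Sum>w\<in>?X. Poly_Mapping.lookup u' w * Poly_Mapping.lookup (deform_lead T c w) x)" for x
    using arg_cong[OF eq, of "\<lambda>p. Poly_Mapping.lookup p x"] mext_nat[OF _ u] mext_nat[OF _ u']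
    by (simp add: lookup_mext)
  have off: "Poly_Mapping.lookup u v = Poly_Mapping.lookup u' v" if "v \<in> ?X" "v \<notin> ?P" for v
  proof -
    have "Poly_Mapping.lookup (deform_lead T c v) (var_y v) = 1"
      using that by (simp add: deform_lead_def lookup_add lookup_single pvar_defs)
    moreover have "Poly_Mapping.lookup (deform_lead T c w) (var_y v) = 0" if "w \<noteq> v" for w
      using that by (simp add: deform_lead_def segre_mono_def lookup_add lookup_single pvar_defs)
    ultimately show ?thesis
      using sum_nat_cancel_term[OF _ that(1) sums[of "var_y v"]] by simp
  qed
  have on: "Poly_Mapping.lookup u (r, k) = Poly_Mapping.lookup u' (r, k)"
    if "(r, k) \<in> ?X" "(r, k) \<in> ?P" for r k
    using that
  proof (induction k arbitrary: r rule: less_induct)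
    case (less k)
    have above: "Poly_Mapping.lookup u (q, k) = Poly_Mapping.lookup u' (q, k)"
      if q: "(q, k) \<in> ?X" "(q, k) \<in> ?P" "c k < q" for q
    proof -
      let ?x = "var_alpha q (block T k)"
      have "Poly_Mapping.lookup (deform_lead T c (q, k)) ?x = 1"
        using q by (simp add: deform_lead_def segre_mono_def lookup_add lookup_single pvar_defs)
      moreover have "Poly_Mapping.lookup u w * Poly_Mapping.lookup (deform_lead T c w) ?x
          = Poly_Mapping.lookup u' w * Poly_Mapping.lookup (deform_lead T c w) ?x"
        if w: "w \<in> ?X" "w \<noteq> (q, k)" for w
      proof (cases "w \<in> ?P \<and> fst w = q \<and> block T (snd w) = block T k")
        case False
        then have "Poly_Mapping.lookup (deform_lead T c w) ?x = 0"
          by (auto simp: deform_lead_def segre_mono_def lookup_add lookup_single pvar_defs)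
        then show ?thesis by simp
      next
        case True
        then obtain l where l: "w = (q, l)" "block T l = block T k" by (cases w) auto
        have "l < k"
        proof (rule ccontr)
          assume "\<not> l < k"
          then have "k < l" using l w by auto
          then have "T \<inter> {k<..l} = {}"
            using l block_eq_iff[OF fin, of k l] by simp
          then have "c (l - 1) \<le> c k"
            using \<open>k < l\<close> w l by (intro steps_antitone[OF st]) (auto simp: disjoint_iff)
          moreover have "q \<le> c (l - 1)"
            using True l by (simp add: lattice_path_def)
          ultimately show False using q by simp
        qed
        then show ?thesis using less.IH[of l q] True w l by simp
      qed
      ultimately show ?thesis
        using sum_nat_cancel_term[OF _ q(1) sums[of ?x]] by simp
    qed
    show ?case
    proof (cases "c k < r")
      case True
      then show ?thesis using above less.prems by blast
    next
      case False
      let ?x = "var_beta k"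
      have "Poly_Mapping.lookup (deform_lead T c (r, k)) ?x = 1"
        using less.prems by (simp add: deform_lead_def segre_mono_def lookup_add lookup_single pvar_defs)
      moreover have "Poly_Mapping.lookup u w * Poly_Mapping.lookup (deform_lead T c w) ?x
          = Poly_Mapping.lookup u' w * Poly_Mapping.lookup (deform_lead T c w) ?x"
        if w: "w \<in> ?X" "w \<noteq> (r, k)" for w
      proof (cases "w \<in> ?P \<and> snd w = k")
        case False
        then have "Poly_Mapping.lookup (deform_lead T c w) ?x = 0"
          by (auto simp: deform_lead_def segre_mono_def lookup_add lookup_single pvar_defs)
        then show ?thesis by simp
      next
        case True
        then obtain q where q: "w = (q, k)" by (cases w) auto
        have "c k \<le> r" "c k \<le> q"
          using less.prems True q by (auto simp: lattice_path_def)
        then have "c k < q" using False q w by auto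
        then show ?thesis using above[of q] w True q by simp
      qed
      ultimately show ?thesis
        using sum_nat_cancel_term[OF _ less.prems(1) sums[of ?x]] by simp
    qed
  qed
  show ?thesis
  proof (rule poly_mapping_eqI)
    fix v :: "nat \<times> nat"
    show "Poly_Mapping.lookup u v = Poly_Mapping.lookup u' v"
    proof (cases "v \<in> ?X")
      case True
      then show ?thesis using on off by (cases v) blast
    next
      case False
      then have "v \<notin> Poly_Mapping.keys u" "v \<notin> Poly_Mapping.keys u'"
        using u u' by blast+
      then show ?thesis by (simp add: in_keys_iff)
    qed
  qed
qed

section \<open>Divisibility of deformed images by powers of \<epsilon>\<close>

lemma deform_minus_segre_vanishes: "deform T c v - segre T v \<in> vanish var_eps 1"
  by (auto simp: deform_def vanish_def lookup_add)

lemma peval_deform_minus_segre: "peval (deform T c) f - peval (segre T) f \<in> vanish var_eps 1"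
  by (intro vanish_peval_diff deform_minus_segre_vanishes)

lemma segre_keys_no_eps:
  assumes "\<kappa> \<in> Poly_Mapping.keys (peval (segre T) f)"
  shows "Poly_Mapping.lookup \<kappa> var_eps = 0"
proof -
  have meval: "Poly_Mapping.lookup \<kappa> var_eps = 0" if "\<kappa> \<in> Poly_Mapping.keys (meval (segre T) u :: (pvar, 'a) mpoly)" for \<kappa> u
    using that
  proof (induction u arbitrary: \<kappa> rule: monomial_induct)
    case zero
    then show ?case by simp
  next
    case (add u v)
    then have "\<kappa> \<in> Poly_Mapping.keys (meval (segre T) u * segre T v :: (pvar, 'a) mpoly)"
      by (simp add: meval_add)
    then obtain a b where ab: "\<kappa> = a + b" "a \<in> Poly_Mapping.keys (meval (segre T) u :: (pvar, 'a) mpoly)"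
        "b \<in> Poly_Mapping.keys (segre T v :: (pvar, 'a) mpoly)"
      by (rule keys_mult_obtain)
    from ab(3) have "Poly_Mapping.lookup b var_eps = 0"
      by (auto simp: segre_def segre_mono_def lookup_add lookup_single pvar_defs split: if_splits)
    then show ?case using ab add.IH by (simp add: lookup_add)
  qed
  show ?thesis
    using assms
  proof (induction f arbitrary: \<kappa> rule: poly_mapping_induct_single)
    case zero
    then show ?case by simp
  next
    case (add f \<mu> d)
    then have "\<kappa> \<in> Poly_Mapping.keys (peval (segre T) f)
        \<or> \<kappa> \<in> Poly_Mapping.keys (Poly_Mapping.single 0 d * meval (segre T) \<mu>)"
      using keys_add[of "peval (segre T) f" "Poly_Mapping.single 0 d * meval (segre T) \<mu>"]
      by (auto simp: peval_add peval_single)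
    then show ?case
      using add.IH meval by (auto elim!: keys_mult_obtain split: if_splits)
  qed
qed

text \<open>Modulo \<epsilon> the deformation is the parametrisation, whose values do not involve
  \<epsilon>.\<close>

lemma deform_not_vanish:
  assumes "peval (segre T) s \<noteq> 0"
  shows "peval (deform T c) s \<notin> vanish var_eps 1"
proof
  assume "peval (deform T c) s \<in> vanish var_eps 1"
  then have "peval (segre T) s \<in> vanish var_eps 1"
    using vanish_diff[OF _ peval_deform_minus_segre[of T c s]] by fastforce
  moreover obtain \<kappa> where "\<kappa> \<in> Poly_Mapping.keys (peval (segre T) s)"
    using assms by (metis ex_in_conv keys_eq_empty)
  ultimately show False
    using segre_keys_no_eps by (fastforce simp: vanish_def)
qed

lemma is_ideal_vanish: "is_ideal (polyS m n) {f \<in> polyS m n. peval \<phi> f \<in> vanish e t}"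
  unfolding is_ideal_def using subring_polyS[of m n]
  by (auto simp: subring_def peval_add peval_uminus peval_mult intro: vanish_add vanish_uminus vanish_mult_left)

text \<open>Modulo \<epsilon> the adjacent minors map to 0, so each factor from the ideal
  contributes one power of \<epsilon>.\<close>

lemma deform_J_pow_vanish:
  assumes "finite T"
  shows "ideal_pow (polyS m n) (J_KmPn m n :: (nat \<times> nat, 'a::field) mpoly set) t
     \<subseteq> {f \<in> polyS m n. peval (deform T c) f \<in> vanish var_eps t}"
proof (induction t)
  case 0
  then show ?case by simp
next
  case (Suc t)
  have J: "J_KmPn m n \<subseteq> {f \<in> polyS m n. peval (deform T c) f \<in> (vanish var_eps 1 :: (pvar, 'a) mpoly set)}"
  proof (rule J_least[OF is_ideal_vanish])
    fix i j k assume "1 \<le> i" "i < j" "j \<le> m" "1 \<le> k" "k < n"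
    then show "minor k (Suc k) i j \<in> {f \<in> polyS m n. peval (deform T c) f \<in> (vanish var_eps 1 :: (pvar, 'a) mpoly set)}"
      using peval_deform_minus_segre[of T c "minor k (Suc k) i j :: (nat \<times> nat, 'a) mpoly"]
      by (auto simp: segre_adjacent_minor[OF assms] intro!: polyS_minor)
  qed
  show ?case
    unfolding ideal_pow.simps ideal_prod_def
  proof (rule ideal_gen_least[OF is_ideal_vanish], clarify)
    fix a b :: "(nat \<times> nat, 'a) mpoly"
    assume "a \<in> ideal_pow (polyS m n) (J_KmPn m n) t" "b \<in> J_KmPn m n"
    then show "a * b \<in> polyS m n \<and> peval (deform T c) (a * b) \<in> vanish var_eps (Suc t)"
      using Suc J vanish_mult[of _ var_eps t _ 1] by (auto simp: peval_mult intro!: polyS_mult)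
  qed
qed

lemma top_monomial_degree_off_path:
  fixes f s :: "(nat \<times> nat, 'a::field) mpoly"
  assumes T: "cuts n T" "steps m n T c" and f: "f \<in> polyS m n"
    and s: "peval (segre T) s \<noteq> 0" "s * f \<in> ideal_pow (polyS m n) (J_KmPn m n) t"
    and u: "u \<in> Poly_Mapping.keys f" and top: "\<And>\<mu>. \<mu> \<in> Poly_Mapping.keys f \<Longrightarrow> mext grid_weight \<mu> \<le> mext grid_weight u"
  shows "t \<le> (\<Sum>v\<in>{1..m} \<times> {1..n} - lattice_path T c. Poly_Mapping.lookup u v)"
proof -
  note fin = finite_cuts[OF T(1)]
  let ?X = "{1..m} \<times> {1..n}"
  have keys: "Poly_Mapping.keys \<mu> \<subseteq> ?X" if "\<mu> \<in> Poly_Mapping.keys f" for \<mu>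
    using f that by (auto simp: polyS_iff_keys)
  have wt: "mext (pvar_weight n T c) (mext (deform_lead T c) \<mu>) = mext grid_weight \<mu>"
    if "\<mu> \<in> Poly_Mapping.keys f" for \<mu>
    unfolding mext_mext using keys[OF that] by (intro mext_cong weight_deform_lead[OF T(2) fin]) auto
  have "peval (deform T c) s * peval (deform T c) f \<in> vanish var_eps t"
    using subsetD[OF deform_J_pow_vanish[OF fin] s(2)] by (simp add: peval_mult)
  \<comment> \<open>The image of \<open>s\<close> is prime to \<epsilon>, so the whole order of
    vanishing belongs to \<open>f\<close>.\<close>
  then have van: "peval (deform T c) f \<in> vanish var_eps t"
    using deform_not_vanish[OF s(1)] by (rule vanish_cancel)
  have "Poly_Mapping.lookup (peval (deform T c) f) (mext (deform_lead T c) u) = Poly_Mapping.lookup f u"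
  proof (rule lookup_peval_led_by[OF _ _ _ u, where \<omega> = "pvar_weight n T c"])
    fix \<mu> v assume "\<mu> \<in> Poly_Mapping.keys f" "v \<in> Poly_Mapping.keys \<mu>"
    then show "led_by (pvar_weight n T c) (deform T c v :: (pvar, 'a) mpoly) (deform_lead T c v)"
      using keys by (intro led_by_deform[OF T(2) fin]) blast
  next
    fix \<mu> assume "\<mu> \<in> Poly_Mapping.keys f"
    then show "mext (pvar_weight n T c) (mext (deform_lead T c) \<mu>) \<le> mext (pvar_weight n T c) (mext (deform_lead T c) u)"
      using top u by (simp add: wt)
  next
    fix \<mu> assume "\<mu> \<in> Poly_Mapping.keys f" "mext (deform_lead T c) \<mu> = mext (deform_lead T c) u"
    then show "\<mu> = u"
      using keys u by (intro deform_lead_inj[OF T(2) fin]) auto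
  qed
  then have "mext (deform_lead T c) u \<in> Poly_Mapping.keys (peval (deform T c) f)"
    using u by (simp add: in_keys_iff)
  then have "t \<le> Poly_Mapping.lookup (mext (deform_lead T c) u) var_eps"
    using van by (auto simp: vanish_def)
  also have "\<dots> = (\<Sum>v\<in>?X. Poly_Mapping.lookup u v * Poly_Mapping.lookup (deform_lead T c v) var_eps)"
    unfolding lookup_mext using keys[OF u] by (intro mext_nat) auto
  also have "\<dots> = (\<Sum>v\<in>?X - lattice_path T c. Poly_Mapping.lookup u v)"
    by (rule sum.mono_neutral_cong_right)
      (auto simp: deform_lead_def segre_mono_def lookup_add lookup_single pvar_defs)
  finally show ?thesis .
qed

section \<open>Initial monomials of the powers\<close>

text \<open>The edges are the heavier terms of the adjacent minors, written with the end in an even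
  column first to make the bipartition explicit.\<close>

definition grid_edges :: "nat \<Rightarrow> nat \<Rightarrow> ((nat \<times> nat) \<times> (nat \<times> nat)) set" where
  "grid_edges m n = {((i, k), (j, l)). i \<in> {1..m} \<and> j \<in> {1..m} \<and> k \<in> {1..n} \<and> l \<in> {1..n} \<and> even k \<and>
     (l = Suc k \<and> i < j \<or> k = Suc l \<and> j < i)}"

text \<open>The complement of a cover is independent, hence contained in a union of lattice paths;
  so the cover contains every cell off these paths.\<close>

lemma vcover_weight_ge:
  assumes m: "m \<ge> 1" and n: "n \<ge> 2" and C: "C \<subseteq> {1..m} \<times> {1..n}" "vcover (grid_edges m n) C"
    and paths: "\<And>T c. cuts n T \<Longrightarrow> steps m n T c \<Longrightarrow> t \<le> sum (u :: _ \<Rightarrow> nat) ({1..m} \<times> {1..n} - lattice_path T c)"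
  shows "t \<le> sum u C"
proof -
  let ?X = "{1..m} \<times> {1..n}"
  define Z where "Z k = {r. (r, k) \<in> ?X - C}" for k
  have indep: "j \<le> i" if "i \<in> Z k" "j \<in> Z (Suc k)" for i j k
  proof (rule ccontr)
    assume "\<not> j \<le> i"
    then have "((i, k), (j, Suc k)) \<in> grid_edges m n \<or> ((j, Suc k), (i, k)) \<in> grid_edges m n"
      using that by (auto simp: grid_edges_def Z_def)
    then show False
      using C(2) that by (fastforce simp: vcover_def Z_def)
  qed
  have Z: "Z k \<subseteq> {1..m}" "Z 0 = {}" "n < k \<Longrightarrow> Z k = {}" for k
    by (auto simp: Z_def)
  obtain T c where Tc: "cuts n T" "steps m n T c" "(\<Union>k. Z k \<times> {k}) \<subseteq> lattice_path T c"
    by (rule independent_subset_lattice_path[of n Z m, OF n Z m indep])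
  then have "?X - lattice_path T c \<subseteq> C"
    by (fastforce simp: Z_def)
  then have "sum u (?X - lattice_path T c) \<le> sum u C"
    using C(1) by (intro sum_mono2) (auto intro: finite_subset)
  with paths[OF Tc(1,2)] show ?thesis by simp
qed

lemma grid_weight_nonneg: "0 \<le> mext grid_weight \<mu>"
  by (simp add: mext_def grid_weight_def sum_nonneg)

text \<open>The diagonal term outweighs the other one by \<open>j - i\<close>.\<close>

lemma led_by_minor:
  assumes "i < j"
  shows "led_by grid_weight (minor k (Suc k) i j)
     (Poly_Mapping.single (i, k) 1 + Poly_Mapping.single (j, Suc k) 1)"
proof -
  have "minor k (Suc k) i j = Poly_Mapping.single (Poly_Mapping.single (i, k) 1 + Poly_Mapping.single (j, Suc k) 1) 1
     + - Poly_Mapping.single (Poly_Mapping.single (i, Suc k) 1 + Poly_Mapping.single (j, k) 1) (1 :: 'a)"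
    by (simp add: minor_def Var_def mult_single)
  also have "led_by grid_weight \<dots> (Poly_Mapping.single (i, k) 1 + Poly_Mapping.single (j, Suc k) 1)"
    using assms by (intro led_by_single_add) (auto simp: keys_uminus_pm mext_add grid_weight_def algebra_simps)
  finally show ?thesis .
qed

lemma edge_minor:
  assumes "(a, b) \<in> grid_edges m n"
  obtains g where "g \<in> (J_KmPn m n :: (nat \<times> nat, 'a::field) mpoly set)"
    "led_by grid_weight g (Poly_Mapping.single a 1 + Poly_Mapping.single b 1)"
proof -
  obtain i k j l where ab: "a = (i, k)" "b = (j, l)" by (cases a, cases b)
  consider "l = Suc k" "i < j" | "k = Suc l" "j < i"
    using assms ab by (auto simp: grid_edges_def)
  then show thesis
  proof cases
    case 1
    show thesis
    proof (rule that)
      show "minor k (Suc k) i j \<in> (J_KmPn m n :: (nat \<times> nat, 'a) mpoly set)"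
        using assms ab 1 by (intro adjacent_minor_in_J) (auto simp: grid_edges_def)
    qed (use 1 ab led_by_minor in simp)
  next
    case 2
    show thesis
    proof (rule that)
      show "minor l (Suc l) j i \<in> (J_KmPn m n :: (nat \<times> nat, 'a) mpoly set)"
        using assms ab 2 by (intro adjacent_minor_in_J) (auto simp: grid_edges_def)
    qed (use 2 ab led_by_minor[of j i l] in \<open>simp add: add.commute\<close>)
  qed
qed

text \<open>Peel off one edge at a time by \<open>konig_step\<close>; each edge is the leader of a
  minor, and leaders multiply.\<close>

lemma led_by_in_J_pow:
  assumes "Poly_Mapping.keys u \<subseteq> {1..m} \<times> {1..n}"
    and "\<And>C. C \<subseteq> {1..m} \<times> {1..n} \<Longrightarrow> vcover (grid_edges m n) C \<Longrightarrow> t \<le> sum (Poly_Mapping.lookup u) C"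
  shows "\<exists>g \<in> ideal_pow (polyS m n) (J_KmPn m n :: (nat \<times> nat, 'a::field) mpoly set) t. led_by grid_weight g u"
  using assms
proof (induction t arbitrary: u)
  case 0
  have "Poly_Mapping.single u 1 \<in> polyS m n"
    using 0(1) by (rule polyS_single)
  then show ?case
    using led_by_single by auto
next
  case (Suc t)
  let ?X = "{1..m} \<times> {1..n}"
  let ?E = "grid_edges m n"
  have "?E \<subseteq> (?X \<inter> {v. even (snd v)}) \<times> (?X - {v. even (snd v)})"
    by (auto simp: grid_edges_def)
  from _ this Suc.prems(2) obtain a b where ab: "(a, b) \<in> ?E" "Poly_Mapping.lookup u a > 0" "Poly_Mapping.lookup u b > 0"
    and both: "\<And>C. C \<subseteq> ?X \<Longrightarrow> vcover ?E C \<Longrightarrow> a \<in> C \<Longrightarrow> b \<in> C \<Longrightarrow> Suc (Suc t) \<le> sum (Poly_Mapping.lookup u) C"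
    by (rule konig_step) auto
  have "a \<noteq> b" using ab(1) by (auto simp: grid_edges_def)
  have "b \<in> Poly_Mapping.keys u"
    using ab(3) by (simp add: in_keys_iff)
  then obtain u1 where u1: "u = u1 + Poly_Mapping.single b 1"
    by (rule monomial_decompose)
  have "a \<in> Poly_Mapping.keys u1"
    using ab(2) \<open>a \<noteq> b\<close> by (auto simp: u1 lookup_add lookup_single in_keys_iff)
  then obtain u2 where u2: "u1 = u2 + Poly_Mapping.single a 1"
    by (rule monomial_decompose)
  \<comment> \<open>A cover loses 2 only if it contains both ends of the edge, and then
    \<open>both\<close> supplies the extra unit.\<close>
  have "t \<le> sum (Poly_Mapping.lookup u2) C" if C: "C \<subseteq> ?X" "vcover ?E C" for C
  proof -
    have "finite C" using C(1) by (rule finite_subset) auto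
    then have "sum (Poly_Mapping.lookup u) C
        = sum (Poly_Mapping.lookup u2) C + (if a \<in> C then 1 else 0) + (if b \<in> C then 1 else 0)"
      by (simp add: u1 u2 lookup_add sum.distrib lookup_single when_def)
    then show ?thesis
      using Suc.prems(2)[OF C] both[OF C] by (auto split: if_splits)
  qed
  moreover have "Poly_Mapping.keys u2 \<subseteq> ?X"
    using Suc.prems(1) by (auto simp: u1 u2 keys_add_nat)
  ultimately obtain g where g: "g \<in> ideal_pow (polyS m n) (J_KmPn m n :: (nat \<times> nat, 'a) mpoly set) t"
      "led_by grid_weight g u2"
    using Suc.IH by blast
  obtain q where q: "q \<in> (J_KmPn m n :: (nat \<times> nat, 'a) mpoly set)"
      "led_by grid_weight q (Poly_Mapping.single a 1 + Poly_Mapping.single b 1)"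
    using edge_minor[OF ab(1)] .
  have "led_by grid_weight (g * q) u"
    using led_by_mult[OF g(2) q(2)] by (simp add: u1 u2 add.assoc)
  then show ?case
    using ideal_pow_SucI[OF g(1) q(1)] by blast
qed

text \<open>Induction on a strict bound for the weights: the top monomials are cancelled by elements
  of the power, and the local hypothesis survives because it is stable under subtracting such
  elements.\<close>

lemma in_J_pow_of_local:
  fixes f :: "(nat \<times> nat, 'a::field) mpoly"
  assumes m: "m \<ge> 1" and n: "n \<ge> 2"
    and "f \<in> polyS m n"
    and "\<And>T. cuts n T \<Longrightarrow> \<exists>s\<in>polyS m n. peval (segre T) s \<noteq> 0 \<and> s * f \<in> ideal_pow (polyS m n) (J_KmPn m n) t"
    and "\<And>\<mu>. \<mu> \<in> Poly_Mapping.keys f \<Longrightarrow> mext grid_weight \<mu> < int N"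
  shows "f \<in> ideal_pow (polyS m n) (J_KmPn m n) t"
  using assms(3-)
proof (induction N arbitrary: f)
  let ?I = "ideal_pow (polyS m n) (J_KmPn m n :: (nat \<times> nat, 'a) mpoly set) t"
  have I: "is_ideal (polyS m n) ?I"
    by (intro is_ideal_ideal_pow subring_polyS is_ideal_J)
  {
    case 0
    have "\<mu> \<notin> Poly_Mapping.keys f" for \<mu>
      using 0(3)[of \<mu>] grid_weight_nonneg[of \<mu>] by auto
    then have "Poly_Mapping.keys f = {}" by blast
    then show ?case
      using ideal_zero[OF I] by simp
  next
    case (Suc N)
    define M where "M = {\<mu> \<in> Poly_Mapping.keys f. mext grid_weight \<mu> = int N}"
    have finM: "finite M" by (simp add: M_def)
    have "\<exists>g\<in>?I. led_by grid_weight g u" if u: "u \<in> M" for u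
    proof (rule led_by_in_J_pow)
      show "Poly_Mapping.keys u \<subseteq> {1..m} \<times> {1..n}"
        using u Suc.prems(1) by (auto simp: M_def polyS_iff_keys)
    next
      fix C assume C: "C \<subseteq> {1..m} \<times> {1..n}" "vcover (grid_edges m n) C"
      show "t \<le> sum (Poly_Mapping.lookup u) C"
      proof (rule vcover_weight_ge[OF m n C])
        fix T c assume T: "cuts n T" "steps m n T c"
        obtain s where "peval (segre T) s \<noteq> 0" "s * f \<in> ?I"
          using Suc.prems(2)[OF T(1)] by blast
        then show "t \<le> sum (Poly_Mapping.lookup u) ({1..m} \<times> {1..n} - lattice_path T c)"
          using u Suc.prems(3) by (intro top_monomial_degree_off_path[OF T Suc.prems(1)]) (fastforce simp: M_def)+
      qed
    qed
    then obtain G where G: "\<And>u. u \<in> M \<Longrightarrow> G u \<in> ?I" "\<And>u. u \<in> M \<Longrightarrow> led_by grid_weight (G u) u"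
      by metis
    define q where "q = (\<Sum>u\<in>M. Poly_Mapping.single 0 (Poly_Mapping.lookup f u) * G u)"
    have q: "q \<in> ?I"
      unfolding q_def using G(1) by (intro ideal_sum[OF I] ideal_mult[OF I] polyS_single) auto
    have lookup_q: "Poly_Mapping.lookup q \<kappa> = (\<Sum>u\<in>M. Poly_Mapping.lookup f u * Poly_Mapping.lookup (G u) \<kappa>)" for \<kappa>
      by (simp add: q_def lookup_sum flip: mult_map_scale_conv_mult,
          auto simp: Poly_Mapping.map.rep_eq when_def intro!: sum.cong)
    have "f - q \<in> ?I"
    proof (rule Suc.IH)
      show "f - q \<in> polyS m n"
        using Suc.prems(1) ideal_subset[OF I q] by (rule polyS_diff)
    next
      fix T assume "cuts n T"
      then obtain s where s: "s \<in> polyS m n" "peval (segre T) s \<noteq> 0" "s * f \<in> ?I"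
        using Suc.prems(2) by blast
      then have "s * (f - q) \<in> ?I"
        using ideal_diff[OF I s(3) ideal_mult[OF I s(1) q]] by (simp add: right_diff_distrib)
      with s show "\<exists>s\<in>polyS m n. peval (segre T) s \<noteq> 0 \<and> s * (f - q) \<in> ?I" by blast
    next
      fix \<kappa> assume \<kappa>: "\<kappa> \<in> Poly_Mapping.keys (f - q)"
      show "mext grid_weight \<kappa> < int N"
      proof (rule ccontr)
        assume ge: "\<not> mext grid_weight \<kappa> < int N"
        \<comment> \<open>No leader \<open>u\<close> is heavier than \<open>\<kappa>\<close>, so
          \<open>\<kappa>\<close> can occur in \<open>G u\<close> only as the leader.\<close>
        have "Poly_Mapping.lookup (G u) \<kappa> = (if u = \<kappa> then 1 else 0)" if "u \<in> M" for u
          using G(2)[OF that] ge that by (auto simp: led_by_def M_def in_keys_iff)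
        then have "Poly_Mapping.lookup q \<kappa> = (if \<kappa> \<in> M then Poly_Mapping.lookup f \<kappa> else 0)"
          using finM by (simp add: lookup_q if_distrib[of "(*) _"] cong: sum.cong if_cong)
        moreover have "\<kappa> \<in> M" if "\<kappa> \<in> Poly_Mapping.keys f"
          using that ge Suc.prems(3)[OF that] by (simp add: M_def)
        ultimately show False
          using \<kappa> by (auto simp: in_keys_iff lookup_minus split: if_splits)
      qed
    qed
    then have "(f - q) + q \<in> ?I" using q by (rule ideal_add[OF I])
    then show ?case by simp
  }
qed

theorem theorem3p13:
  fixes m n t :: nat
  assumes "m \<ge> 2" and "n \<ge> 2" and "t \<ge> 1"
  shows "symbolic_power (polyS m n) (J_KmPn m n :: (nat \<times> nat, 'a::field) mpoly set) t
         = ideal_pow (polyS m n) (J_KmPn m n) t"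
proof
  let ?S = "polyS m n :: (nat \<times> nat, 'a) mpoly set"
  let ?J = "J_KmPn m n :: (nat \<times> nat, 'a) mpoly set"
  have I: "is_ideal ?S (ideal_pow ?S ?J t)"
    by (intro is_ideal_ideal_pow subring_polyS is_ideal_J)
  have one: "1 \<in> ?S"
    using subring_polyS by (auto simp: subring_def)
  show "ideal_pow ?S ?J t \<subseteq> symbolic_power ?S ?J t"
  proof
    fix f assume f: "f \<in> ideal_pow ?S ?J t"
    \<comment> \<open>A proper ideal omits 1, so 1 is an admissible denominator.\<close>
    have "1 \<in> ?S - P" if "P \<in> Ass ?S ?J" for P
    proof -
      have "is_ideal ?S P" "P \<noteq> ?S"
        using that by (auto simp: Ass_def prime_ideal_def)
      then show ?thesis
        using one ideal_mult[of ?S P _ 1] ideal_subset[of ?S P] by auto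
    qed
    then show "f \<in> symbolic_power ?S ?J t"
      using f ideal_subset[OF I f] by (force simp: symbolic_power_def loc_contract_def)
  qed
  show "symbolic_power ?S ?J t \<subseteq> ideal_pow ?S ?J t"
  proof
    fix f assume f: "f \<in> symbolic_power ?S ?J t"
    \<comment> \<open>All weights are nonnegative, so their sum bounds each of them.\<close>
    define N where "N = nat (\<Sum>\<mu>\<in>Poly_Mapping.keys f. mext grid_weight \<mu>) + 1"
    show "f \<in> ideal_pow ?S ?J t"
    proof (rule in_J_pow_of_local)
      fix T assume "cuts n T"
      then have "segre_prime m n T \<in> Ass ?S ?J"
        using assms by (intro segre_prime_in_Ass)
      then have "f \<in> loc_contract ?S (segre_prime m n T) (ideal_pow ?S ?J t)"
        using f by (auto simp: symbolic_power_def)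
      then show "\<exists>s\<in>?S. peval (segre T) s \<noteq> 0 \<and> s * f \<in> ideal_pow ?S ?J t"
        by (auto simp: loc_contract_def segre_prime_def)
    next
      fix \<mu> assume "\<mu> \<in> Poly_Mapping.keys f"
      then have "mext grid_weight \<mu> \<le> (\<Sum>\<mu>\<in>Poly_Mapping.keys f. mext grid_weight \<mu>)"
        by (intro member_le_sum) (auto simp: grid_weight_nonneg)
      then show "mext grid_weight \<mu> < int N" by (simp add: N_def)
    qed (use assms f in \<open>auto simp: symbolic_power_def\<close>)
  qed
qed

end
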